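(* Let $S$ be a set of patterns such that either no $\pi\in S$ satisfies $\pi(1)=1$, or no $\pi\in S$ satisfies $\pi(1)=k$ where $k$ is the length of $\pi$. For $n\ge 1$ let $f_n(S)$ and $t_n(S)$ denote the number of rooted labeled forests on $[n]$, respectively rooted labeled trees on $[n]$, that avoid $S$. Then the limits \[\lim_{n\rightarrow\infty}\frac{f_n(S)^{1/n}}n\quad\text{and}\quad\lim_{n\rightarrow\infty}\frac{t_n(S)^{1/n}}n\] both exist and are equal.
   Context: A pattern is a permutation $\pi=\pi(1)\cdots\pi(k)$ of $[k]=\{1,\dots,k\}$. A rooted labeled forest on $[n]$ is an unordered (non-planar) forest on $n$ vertices, with each vertex carrying a distinct label in $[n]$, in which each connected component has a distinguished root; a rooted labeled tree is such a forest with one component. An instance of $\pi$ in a forest $F$ is a sequence of vertices $v_1,\dots,v_k$ such that $v_i$ is an ancestor of $v_{i+1}$ for all $1\le i<k$ and the labels of $v_1,\dots,v_k$ are in the same relative order as $\pi(1),\dots,\pi(k)$. A forest avoids a set $S$ of patterns if it contains no instance of any $\pi\in S$ (equivalently, the label sequence along every root-to-leaf path avoids every $\pi\in S$ in the classical permutation sense). *)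

theory Defs
  imports Complex_Main
begin

text \<open>
  A pattern is written in one-line notation: the list \<open>[\<pi>(1), \<dots>, \<pi>(k)]\<close> with \<open>k \<ge> 1\<close>.
\<close>

definition is_pattern :: "nat list \<Rightarrow> bool" where
  "is_pattern \<pi> \<longleftrightarrow> \<pi> \<noteq> [] \<and> distinct \<pi> \<and> set \<pi> = {1..length \<pi>}"

text \<open>
  Every vertex of a labeled forest on \<open>[n]\<close> is identified with its label, so the vertex set is
  \<open>{1..n}\<close>. A simple graph is given by its symmetric, irreflexive adjacency relation \<open>E\<close>, so
  that \<open>(u, v) \<in> E\<^sup>*\<close> says that \<open>u\<close> and \<open>v\<close> lie in the same connected component.
\<close>

definition simple_graph_on :: "nat set \<Rightarrow> nat rel \<Rightarrow> bool" where
  "simple_graph_on V E \<longleftrightarrow> E \<subseteq> V \<times> V \<and> sym E \<and> irrefl E"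

definition is_path :: "nat rel \<Rightarrow> nat \<Rightarrow> nat list \<Rightarrow> nat \<Rightarrow> bool" where
  "is_path E u xs v \<longleftrightarrow>
     xs \<noteq> [] \<and> hd xs = u \<and> last xs = v \<and> distinct xs \<and> successively (\<lambda>x y. (x, y) \<in> E) xs"

definition is_cycle :: "nat rel \<Rightarrow> nat list \<Rightarrow> bool" where
  "is_cycle E xs \<longleftrightarrow>
     length xs \<ge> 3 \<and> distinct xs \<and> successively (\<lambda>x y. (x, y) \<in> E) xs \<and> (last xs, hd xs) \<in> E"

text \<open>
  A rooted labeled forest is a pair \<open>(E, R)\<close> of a forest and its set of distinguished roots, one
  in each connected component.
\<close>

definition rooted_forest_on :: "nat \<Rightarrow> nat rel \<times> nat set \<Rightarrow> bool" where
  "rooted_forest_on n = (\<lambda>(E, R).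
     simple_graph_on {1..n} E \<and> (\<nexists>xs. is_cycle E xs) \<and>
     R \<subseteq> {1..n} \<and> (\<forall>v\<in>{1..n}. \<exists>!r. r \<in> R \<and> (r, v) \<in> E\<^sup>*))"

definition rooted_tree_on :: "nat \<Rightarrow> nat rel \<times> nat set \<Rightarrow> bool" where
  "rooted_tree_on n F \<longleftrightarrow>
     rooted_forest_on n F \<and> n \<ge> 1 \<and> (\<forall>u\<in>{1..n}. \<forall>v\<in>{1..n}. (u, v) \<in> (fst F)\<^sup>*)"

text \<open>
  Ancestors are proper: the ancestors of \<open>v\<close> are the vertices other than \<open>v\<close> on the path from
  the root of its component to \<open>v\<close>.
\<close>

definition is_ancestor :: "nat rel \<times> nat set \<Rightarrow> nat \<Rightarrow> nat \<Rightarrow> bool" where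
  "is_ancestor = (\<lambda>(E, R) u v. u \<noteq> v \<and> (\<exists>r\<in>R. \<exists>xs. is_path E r xs v \<and> u \<in> set xs))"

definition is_instance :: "nat \<Rightarrow> nat rel \<times> nat set \<Rightarrow> nat list \<Rightarrow> nat list \<Rightarrow> bool" where
  "is_instance n F \<pi> vs \<longleftrightarrow>
     length vs = length \<pi> \<and> set vs \<subseteq> {1..n} \<and> successively (is_ancestor F) vs \<and>
     (\<forall>i<length \<pi>. \<forall>j<length \<pi>. vs ! i < vs ! j \<longleftrightarrow> \<pi> ! i < \<pi> ! j)"

definition avoids :: "nat \<Rightarrow> nat rel \<times> nat set \<Rightarrow> nat list set \<Rightarrow> bool" where
  "avoids n F S \<longleftrightarrow> (\<forall>\<pi>\<in>S. \<nexists>vs. is_instance n F \<pi> vs)"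

definition num_forests :: "nat list set \<Rightarrow> nat \<Rightarrow> nat" where
  "num_forests S n = card {F. rooted_forest_on n F \<and> avoids n F S}"

definition num_trees :: "nat list set \<Rightarrow> nat \<Rightarrow> nat" where
  "num_trees S n = card {F. rooted_tree_on n F \<and> avoids n F S}"

end

theory Submission
  imports Defs "HOL-Library.FuncSet" "HOL-Library.Infinite_Set" "HOL-Real_Asymp.Real_Asymp"
begin

text \<open>
  If no pattern starts with its minimum (maximum), a new root carrying the smallest (largest) label
  cannot occur in an instance, so joining the components of an avoiding forest under such a root
  gives an avoiding tree, and \<open>t\<^sub>n \<le> f\<^sub>n \<le> t\<^bsub>n+1\<^esub>\<close>. A disjoint union of two avoiding trees is
  recovered from the component of label 1, whence \<open>(m+n choose m) t\<^sub>m t\<^sub>n \<le> 2 f\<^bsub>m+n\<^esub> \<le> 2 t\<^bsub>m+n+1\<^esub>\<close>.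
  So \<open>A\<^sub>n = t\<^bsub>n-1\<^esub> / (n-1)!\<close> satisfies \<open>A\<^sub>m A\<^sub>n \<le> 2 (m+n) A\<^bsub>m+n\<^esub>\<close>. A Fekete argument with balanced
  splittings, in which the polynomial losses do not accumulate, gives the convergence of
  \<open>A\<^sub>n\<^bsup>1/n\<^esup>\<close>. The limit is finite because there are at most \<open>2\<^sup>n (n+1)\<^sup>n\<close> rooted forests.
\<close>

subsection \<open>Forests on arbitrary vertex sets\<close>

text \<open>The two trees of a disjoint union, and a forest without its new root, have label sets
  other than \<open>{1..n}\<close>. The notions of the statement are therefore restated over an
  arbitrary vertex set \<open>V\<close>.\<close>

definition forest_on :: "nat set \<Rightarrow> nat rel \<times> nat set \<Rightarrow> bool" where
  "forest_on V = (\<lambda>(E, R).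
     simple_graph_on V E \<and> (\<nexists>xs. is_cycle E xs) \<and>
     R \<subseteq> V \<and> (\<forall>v\<in>V. \<exists>!r. r \<in> R \<and> (r, v) \<in> E\<^sup>*))"

definition tree_on :: "nat set \<Rightarrow> nat rel \<times> nat set \<Rightarrow> bool" where
  "tree_on V F \<longleftrightarrow> forest_on V F \<and> V \<noteq> {} \<and> (\<forall>u\<in>V. \<forall>v\<in>V. (u, v) \<in> (fst F)\<^sup>*)"

definition instance_on :: "nat set \<Rightarrow> nat rel \<times> nat set \<Rightarrow> nat list \<Rightarrow> nat list \<Rightarrow> bool" where
  "instance_on V F \<pi> vs \<longleftrightarrow>
     length vs = length \<pi> \<and> set vs \<subseteq> V \<and> successively (is_ancestor F) vs \<and>
     (\<forall>i<length \<pi>. \<forall>j<length \<pi>. vs ! i < vs ! j \<longleftrightarrow> \<pi> ! i < \<pi> ! j)"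

definition avoids_on :: "nat set \<Rightarrow> nat rel \<times> nat set \<Rightarrow> nat list set \<Rightarrow> bool" where
  "avoids_on V F S \<longleftrightarrow> (\<forall>\<pi>\<in>S. \<nexists>vs. instance_on V F \<pi> vs)"

definition forests :: "nat set \<Rightarrow> nat list set \<Rightarrow> (nat rel \<times> nat set) set" where
  "forests V S = {F. forest_on V F \<and> avoids_on V F S}"

definition trees :: "nat set \<Rightarrow> nat list set \<Rightarrow> (nat rel \<times> nat set) set" where
  "trees V S = {F. tree_on V F \<and> avoids_on V F S}"

lemma avoids_eq_avoids_on: "avoids n F S \<longleftrightarrow> avoids_on {1..n} F S"
  by (simp add: avoids_def avoids_on_def is_instance_def instance_on_def)

lemma num_forests_eq: "num_forests S n = card (forests {1..n} S)"
  by (simp add: num_forests_def forests_def avoids_eq_avoids_on rooted_forest_on_def forest_on_def)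

lemma num_trees_eq: "num_trees S n = card (trees {1..n} S)"
  by (simp add: num_trees_def trees_def avoids_eq_avoids_on rooted_tree_on_def tree_on_def
      rooted_forest_on_def forest_on_def Suc_le_eq)

lemma tree_on_imp_forest_on: "tree_on V F \<Longrightarrow> forest_on V F"
  by (simp add: tree_on_def)

lemma trees_subset_forests: "trees V S \<subseteq> forests V S"
  by (auto simp: trees_def forests_def tree_on_def)

lemma forest_onD:
  assumes "forest_on V (E, R)"
  shows "E \<subseteq> V \<times> V" "sym E" "irrefl E" "\<And>xs. \<not> is_cycle E xs" "R \<subseteq> V"
    "\<And>v. v \<in> V \<Longrightarrow> \<exists>r\<in>R. (r, v) \<in> E\<^sup>*"
    "\<And>r s v. v \<in> V \<Longrightarrow> r \<in> R \<Longrightarrow> s \<in> R \<Longrightarrow> (r, v) \<in> E\<^sup>* \<Longrightarrow> (s, v) \<in> E\<^sup>* \<Longrightarrow> r = s"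
  using assms unfolding forest_on_def simple_graph_on_def by blast+

lemma forest_onI:
  assumes "E \<subseteq> V \<times> V" "sym E" "irrefl E" "\<And>xs. \<not> is_cycle E xs" "R \<subseteq> V"
    "\<And>v. v \<in> V \<Longrightarrow> \<exists>r\<in>R. (r, v) \<in> E\<^sup>*"
    "\<And>r s v. v \<in> V \<Longrightarrow> r \<in> R \<Longrightarrow> s \<in> R \<Longrightarrow> (r, v) \<in> E\<^sup>* \<Longrightarrow> (s, v) \<in> E\<^sup>* \<Longrightarrow> r = s"
  shows "forest_on V (E, R)"
  using assms unfolding forest_on_def simple_graph_on_def by blast

lemma finite_forests: "finite V \<Longrightarrow> finite (forests V S)"
  by (rule finite_subset[of _ "Pow (V \<times> V) \<times> Pow V"])
     (auto simp: forests_def dest: forest_onD(1,5))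

lemma finite_trees: "finite V \<Longrightarrow> finite (trees V S)"
  using finite_forests trees_subset_forests finite_subset by metis

section \<open>Walks, cycles and ancestors inside the vertex set\<close>

text \<open>Confines a chain to a set closed under its step relation. It serves for paths and
  cycles, and later for chains of ancestors in a disjoint union, where \<open>Q\<close> is the
  relation of one half.\<close>

lemma successively_stays:
  assumes "successively P xs" "xs \<noteq> []" "hd xs \<in> V"
    and "\<And>x y. P x y \<Longrightarrow> x \<in> V \<Longrightarrow> y \<in> V \<and> Q x y"
  shows "set xs \<subseteq> V \<and> successively Q xs"
  using assms(1-3)
proof (induction xs)
  case (Cons x xs)
  show ?case
  proof (cases "xs = []")
    case False
    hence "P x (hd xs)" "successively P xs"
      using Cons.prems by (auto simp: successively_Cons)
    thus ?thesis
      using Cons.IH Cons.prems assms(4)[of x "hd xs"] False by (auto simp: successively_Cons)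
  qed (use Cons.prems in auto)
qed simp

lemma successively_rtrancl:
  assumes "successively (\<lambda>x y. (x, y) \<in> E) xs" "xs \<noteq> []"
  shows "(hd xs, last xs) \<in> E\<^sup>*"
  using assms
proof (induction xs)
  case (Cons x xs)
  thus ?case
    by (cases "xs = []") (auto simp: successively_Cons intro: converse_rtrancl_into_rtrancl)
qed simp

lemma path_vertices:
  assumes "is_path E u xs v" "u \<in> V" "E \<subseteq> V \<times> V"
  shows "set xs \<subseteq> V"
  using successively_stays[of "\<lambda>x y. (x, y) \<in> E" xs V "\<lambda>_ _. True"] assms
  by (auto simp: is_path_def)

lemma cycle_vertices:
  assumes "is_cycle E xs" "E \<subseteq> V \<times> V"
  shows "set xs \<subseteq> V"
proof -
  have "xs \<noteq> []" "hd xs \<in> V"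
    using assms by (auto simp: is_cycle_def)
  thus ?thesis
    using successively_stays[of "\<lambda>x y. (x, y) \<in> E" xs V "\<lambda>_ _. True"] assms
    by (auto simp: is_cycle_def)
qed

text \<open>Lets a cycle through a given vertex begin there.\<close>

lemma is_cycle_rotate:
  assumes "is_cycle E (xs @ ys)"
  shows "is_cycle E (ys @ xs)"
  using assms by (cases "xs = []"; cases "ys = []")
    (auto simp: is_cycle_def successively_append_iff hd_append last_append)

lemma ancestor_vertices:
  assumes "is_ancestor (E, R) u v" "E \<subseteq> V \<times> V" "R \<subseteq> V"
  shows "u \<in> V" "v \<in> V"
proof -
  obtain r xs where "r \<in> R" "is_path E r xs v" "u \<in> set xs"
    using assms(1) by (auto simp: is_ancestor_def)
  moreover have "v \<in> set xs"
    using \<open>is_path E r xs v\<close> by (auto simp: is_path_def)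
  ultimately show "u \<in> V" "v \<in> V"
    using path_vertices[of E r xs v V] assms by auto
qed

subsection \<open>Relabeling\<close>

definition relabel :: "(nat \<Rightarrow> nat) \<Rightarrow> nat rel \<times> nat set \<Rightarrow> nat rel \<times> nat set" where
  "relabel f = (\<lambda>(E, R). (map_prod f f ` E, f ` R))"

lemma successively_relabel:
  "successively (\<lambda>x y. (x, y) \<in> E) xs \<Longrightarrow>
     successively (\<lambda>x y. (x, y) \<in> map_prod f f ` E) (map f xs)"
  by (auto simp: successively_map elim!: successively_mono)

lemma is_path_relabel:
  assumes "is_path E u xs v" "inj_on f V" "set xs \<subseteq> V"
  shows "is_path (map_prod f f ` E) (f u) (map f xs) (f v)"
  using assms successively_relabel[of E xs f]
  by (auto simp: is_path_def hd_map last_map distinct_map intro: inj_on_subset)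

lemma is_cycle_relabel:
  assumes "is_cycle E xs" "inj_on f V" "set xs \<subseteq> V"
  shows "is_cycle (map_prod f f ` E) (map f xs)"
proof -
  have "xs \<noteq> []"
    using assms by (auto simp: is_cycle_def)
  thus ?thesis
    using assms successively_relabel[of E xs f]
    by (auto simp: is_cycle_def hd_map last_map distinct_map intro: inj_on_subset)
qed

lemma rtrancl_relabel: "(u, v) \<in> E\<^sup>* \<Longrightarrow> (f u, f v) \<in> (map_prod f f ` E)\<^sup>*"
  by (induction rule: rtrancl_induct) (auto intro: rtrancl_into_rtrancl)

lemma ancestor_relabel:
  assumes "is_ancestor (E, R) u v" "inj_on f V" "E \<subseteq> V \<times> V" "R \<subseteq> V"
  shows "is_ancestor (relabel f (E, R)) (f u) (f v)"
proof -
  obtain r xs where r: "r \<in> R" "is_path E r xs v" "u \<in> set xs" "u \<noteq> v"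
    using assms(1) by (auto simp: is_ancestor_def)
  have "set xs \<subseteq> V"
    using path_vertices r assms by blast
  hence "is_path (map_prod f f ` E) (f r) (map f xs) (f v)"
    using is_path_relabel r assms by blast
  moreover have "f u \<noteq> f v"
    using ancestor_vertices[OF assms(1,3,4)] r(4) assms(2) by (auto dest: inj_onD)
  ultimately show ?thesis
    using r unfolding is_ancestor_def relabel_def
    by (auto intro!: bexI[of _ r] exI[of _ "map f xs"])
qed

lemma relabel_inv_into:
  assumes "inj_on f V" "E \<subseteq> V \<times> V" "R \<subseteq> V"
  shows "relabel (inv_into V f) (relabel f (E, R)) = (E, R)"
proof -
  have "map_prod (inv_into V f) (inv_into V f) ` map_prod f f ` E = id ` E"
    unfolding image_image using assms by (intro image_cong) (auto simp: inv_into_f_f)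
  moreover have "inv_into V f ` f ` R = id ` R"
    unfolding image_image using assms by (intro image_cong) (auto simp: inv_into_f_f)
  ultimately show ?thesis
    by (simp add: relabel_def)
qed

text \<open>Existence of roots is pushed forward along \<open>f\<close>. A cycle, or two roots
  connected to the same vertex, in the image would be pulled back along \<open>inv_into V f\<close>
  to the original forest.\<close>

lemma forest_on_relabel:
  assumes "forest_on V F" "inj_on f V"
  shows "forest_on (f ` V) (relabel f F)"
proof -
  obtain E R where F: "F = (E, R)"
    by (cases F)
  note D = forest_onD[OF assms(1)[unfolded F]]
  define g where "g = inv_into V f"
  define E' where "E' = map_prod f f ` E"
  have gf: "g (f v) = v" if "v \<in> V" for v
    using that assms(2) by (simp add: g_def)
  have E'_sub: "E' \<subseteq> f ` V \<times> f ` V"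
    using D(1) by (auto simp: E'_def)
  have gE': "map_prod g g ` E' = E"
    using relabel_inv_into[OF assms(2) D(1,5)] by (simp add: relabel_def E'_def g_def)
  have pull: "(u, v) \<in> E\<^sup>*" if "(f u, f v) \<in> E'\<^sup>*" "u \<in> V" "v \<in> V" for u v
    using rtrancl_relabel[OF that(1), of g] that gf gE' by simp
  have "forest_on (f ` V) (E', f ` R)"
  proof (rule forest_onI)
    show "sym E'"
      using D(2) unfolding E'_def sym_def by force
    show "irrefl E'"
      using D(1,3) assms(2) unfolding E'_def irrefl_def by (force dest: inj_onD)
    show "\<not> is_cycle E' xs" for xs
    proof
      assume "is_cycle E' xs"
      hence "is_cycle (map_prod g g ` E') (map g xs)"
        using is_cycle_relabel[of E' xs g "f ` V"] cycle_vertices[OF _ E'_sub]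
        by (auto simp: g_def inj_on_inv_into)
      thus False
        using D(4) gE' by simp
    qed
    show "\<exists>r\<in>f ` R. (r, v) \<in> E'\<^sup>*" if v: "v \<in> f ` V" for v
    proof -
      obtain u where u: "v = f u" "u \<in> V"
        using v by blast
      then obtain r where "r \<in> R" "(r, u) \<in> E\<^sup>*"
        using D(6) by blast
      thus ?thesis
        using rtrancl_relabel[of r u E f] u by (auto simp: E'_def)
    qed
    show "r = s" if rsv: "v \<in> f ` V" "r \<in> f ` R" "s \<in> f ` R" "(r, v) \<in> E'\<^sup>*" "(s, v) \<in> E'\<^sup>*"
      for r s v
    proof -
      obtain v' r' s' where *: "v = f v'" "r = f r'" "s = f s'" "v' \<in> V" "r' \<in> R" "s' \<in> R"
        using rsv by blast
      hence "(r', v') \<in> E\<^sup>*" "(s', v') \<in> E\<^sup>*"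
        using pull rsv D(5) by auto
      thus ?thesis
        using D(7) * by blast
    qed
  qed (use D E'_sub in auto)
  thus ?thesis
    by (simp add: F relabel_def E'_def)
qed

lemma tree_on_relabel:
  assumes "tree_on V F" "inj_on f V"
  shows "tree_on (f ` V) (relabel f F)"
proof -
  have "fst (relabel f F) = map_prod f f ` fst F"
    by (cases F) (simp add: relabel_def)
  thus ?thesis
    using assms(1) forest_on_relabel[OF _ assms(2), of F] rtrancl_relabel[of _ _ "fst F" f]
    unfolding tree_on_def by simp
qed

text \<open>The inverse of \<open>f\<close> carries an instance in the image back to
  \<open>V\<close>. Strict monotonicity is what keeps the relative order of its labels.\<close>

lemma avoids_on_relabel:
  assumes "forest_on V F" "avoids_on V F S" "strict_mono_on V f"
  shows "avoids_on (f ` V) (relabel f F) S"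
  unfolding avoids_on_def
proof (intro ballI notI)
  fix \<pi> assume \<pi>: "\<pi> \<in> S" and "\<exists>vs. instance_on (f ` V) (relabel f F) \<pi> vs"
  then obtain vs where vs: "instance_on (f ` V) (relabel f F) \<pi> vs"
    by blast
  obtain E R where F: "F = (E, R)"
    by (cases F)
  note D = forest_onD[OF assms(1)[unfolded F]]
  have inj: "inj_on f V"
    using assms(3) by (rule strict_mono_on_imp_inj_on)
  define g where "g = inv_into V f"
  have gf: "g (f v) = v" if "v \<in> V" for v
    using that inj by (simp add: g_def)
  have g_less: "g x < g y \<longleftrightarrow> x < y" if "x \<in> f ` V" "y \<in> f ` V" for x y
    using that strict_mono_on_less[OF assms(3)] by (auto simp: gf)
  have "is_ancestor F (g u) (g v)" if "is_ancestor (relabel f F) u v" for u v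
  proof -
    have "is_ancestor (relabel g (relabel f F)) (g u) (g v)"
      using that unfolding F relabel_def prod.case
      by (rule ancestor_relabel[where V = "f ` V", unfolded relabel_def prod.case])
         (use D in \<open>auto simp: g_def inj_on_inv_into\<close>)
    thus ?thesis
      using relabel_inv_into[OF inj D(1,5)] by (simp add: F g_def)
  qed
  hence "successively (is_ancestor F) (map g vs)"
    using vs by (auto simp: instance_on_def successively_map elim: successively_mono)
  moreover have "set (map g vs) \<subseteq> V"
    using vs gf by (auto simp: instance_on_def)
  moreover have "vs ! i \<in> f ` V" if "i < length \<pi>" for i
    using vs that by (auto simp: instance_on_def)
  ultimately have "instance_on V F \<pi> (map g vs)"
    using vs by (auto simp: instance_on_def g_less)
  thus False
    using assms(2) \<pi> by (auto simp: avoids_on_def)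
qed

lemma inj_on_relabel:
  assumes "inj_on f V"
  shows "inj_on (relabel f) {F. forest_on V F}"
proof (rule inj_on_inverseI)
  fix F assume "F \<in> {F. forest_on V F}"
  hence "forest_on V (fst F, snd F)"
    by simp
  from relabel_inv_into[OF assms forest_onD(1,5)[OF this]]
  show "relabel (inv_into V f) (relabel f F) = F"
    by simp
qed

lemma card_relabel_le:
  assumes "finite V" "strict_mono_on V f"
  shows "card (forests V S) \<le> card (forests (f ` V) S)" "card (trees V S) \<le> card (trees (f ` V) S)"
proof -
  have inj: "inj_on f V"
    using assms(2) by (rule strict_mono_on_imp_inj_on)
  show "card (forests V S) \<le> card (forests (f ` V) S)"
    by (rule card_inj_on_le[of "relabel f"])
       (use assms inj in \<open>auto simp: forests_def avoids_on_relabel forest_on_relabel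
          intro: inj_on_subset[OF inj_on_relabel] finite_forests[unfolded forests_def]\<close>)
  show "card (trees V S) \<le> card (trees (f ` V) S)"
    by (rule card_inj_on_le[of "relabel f"])
       (use assms inj in \<open>auto simp: trees_def avoids_on_relabel tree_on_imp_forest_on
          intro: inj_on_subset[OF inj_on_relabel] tree_on_relabel finite_trees[unfolded trees_def]\<close>)
qed

text \<open>The order-preserving bijection from \<open>{1..card V}\<close> to \<open>V\<close>
  transfers the counts. Only lower bounds for the counts on \<open>V\<close> are used later, so one
  direction suffices.\<close>

lemma num_le_card:
  assumes "finite V"
  shows "num_forests S (card V) \<le> card (forests V S)" "num_trees S (card V) \<le> card (trees V S)"
proof -
  obtain h where h: "bij_betw h {..<card V} V" "strict_mono_on {..<card V} h"
    using ex_bij_betw_strict_mono_card[OF assms] .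
  \<comment> \<open>The enumeration \<open>h\<close> starts at 0, the labels at 1.\<close>
  define f where "f x = h (x - 1)" for x
  have mono: "strict_mono_on {1..card V} f"
  proof (rule strict_mono_onI)
    fix r s assume "r \<in> {1..card V}" "s \<in> {1..card V}" "r < s"
    hence "r - 1 \<in> {..<card V}" "s - 1 \<in> {..<card V}" "r - 1 < s - 1"
      by auto
    thus "f r < f s"
      unfolding f_def by (rule strict_mono_onD[OF h(2)])
  qed
  have "f ` {1..card V} = h ` (\<lambda>x. x - 1) ` {1..card V}"
    by (simp add: f_def image_image)
  also have "(\<lambda>x. x - 1) ` {1..card V} = {..<card V}"
    by (auto simp: image_iff intro!: bexI[of _ "Suc _"])
  also have "h ` {..<card V} = V"
    using h(1) by (simp add: bij_betw_def)
  finally show "num_forests S (card V) \<le> card (forests V S)"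
      "num_trees S (card V) \<le> card (trees V S)"
    using card_relabel_le[OF _ mono, of S] by (simp_all add: num_forests_eq num_trees_eq)
qed

subsection \<open>Adding a root\<close>

definition add_root :: "nat \<Rightarrow> nat rel \<times> nat set \<Rightarrow> nat rel \<times> nat set" where
  "add_root z = (\<lambda>(E, R). (E \<union> {z} \<times> R \<union> R \<times> {z}, {z}))"

lemma successively_add_root:
  assumes "successively (\<lambda>x y. (x, y) \<in> fst (add_root z (E, R))) xs" "z \<notin> set xs"
  shows "successively (\<lambda>x y. (x, y) \<in> E) xs"
  by (rule successively_mono[OF assms(1)]) (use assms(2) in \<open>auto simp: add_root_def\<close>)

text \<open>A cycle through \<open>z\<close> enters and leaves \<open>z\<close> by two old roots
  that are joined by a walk in \<open>E\<close>. One root per component makes them equal, whereas a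
  cycle has two distinct neighbours of \<open>z\<close>.\<close>

lemma tree_on_add_root:
  assumes "forest_on V F" "z \<notin> V"
  shows "tree_on (insert z V) (add_root z F)"
proof -
  obtain E R where F: "F = (E, R)"
    by (cases F)
  note D = forest_onD[OF assms(1)[unfolded F]]
  define E' where "E' = E \<union> {z} \<times> R \<union> R \<times> {z}"
  have E': "fst (add_root z (E, R)) = E'"
    by (simp add: add_root_def E'_def)
  have zE: "(z, v) \<notin> E" "(v, z) \<notin> E" "z \<notin> R" for v
    using D(1,5) assms(2) by auto
  have zv: "(z, v) \<in> E'\<^sup>*" if v: "v \<in> insert z V" for v
  proof (cases "v = z")
    case False
    then obtain r where "r \<in> R" "(r, v) \<in> E\<^sup>*"
      using v D(6) by blast
    moreover have "(r, v) \<in> E'\<^sup>*"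
      using rtrancl_mono[of E E'] \<open>(r, v) \<in> E\<^sup>*\<close> by (auto simp: E'_def)
    moreover have "(z, r) \<in> E'"
      using \<open>r \<in> R\<close> by (simp add: E'_def)
    ultimately show ?thesis
      by (blast intro: converse_rtrancl_into_rtrancl)
  qed simp
  have sym: "sym E'"
    using D(2) by (auto simp: E'_def sym_def)
  have no_cycle: "\<not> is_cycle E' xs" for xs
  proof
    assume cyc: "is_cycle E' xs"
    show False
    proof (cases "z \<in> set xs")
      case False
      have ne: "xs \<noteq> []"
        using cyc by (auto simp: is_cycle_def)
      hence "last xs \<noteq> z" "hd xs \<noteq> z"
        using False by (metis last_in_set, metis hd_in_set)
      hence "is_cycle E xs"
        using cyc False successively_add_root[of z E R xs] unfolding E'
        by (auto simp: is_cycle_def E'_def)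
      thus False
        using D(4) by blast
    next
      case True
      then obtain as bs where xs: "xs = as @ z # bs"
        by (meson split_list)
      define ys where "ys = bs @ as"
      have cyc': "is_cycle E' (z # ys)"
        using is_cycle_rotate[of E' as "z # bs"] cyc by (simp add: xs ys_def)
      hence ys: "length ys \<ge> 2" "distinct ys" "z \<notin> set ys" "successively (\<lambda>x y. (x, y) \<in> E') ys"
          "(z, hd ys) \<in> E'" "(last ys, z) \<in> E'"
        by (auto simp: is_cycle_def successively_Cons split: if_splits)
      have ne: "ys \<noteq> []"
        using ys(1) by auto
      have RR: "hd ys \<in> R" "last ys \<in> R"
        using ys(5,6) zE by (auto simp: E'_def)
      have "successively (\<lambda>x y. (x, y) \<in> E) ys"
        using successively_add_root[of z E R ys] ys unfolding E' by simp
      hence "(hd ys, last ys) \<in> E\<^sup>*"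
        using ne by (rule successively_rtrancl)
      hence "hd ys = last ys"
        using D(5) D(7)[of "last ys" "hd ys" "last ys"] RR by auto
      moreover have "hd ys \<noteq> last ys"
        using ys(1,2) ne by (cases ys) auto
      ultimately show False
        by simp
    qed
  qed
  have "forest_on (insert z V) (E', {z})"
    using D zE zv sym no_cycle
    by (intro forest_onI) (auto simp: E'_def irrefl_def)
  moreover have "(u, v) \<in> E'\<^sup>*" if "u \<in> insert z V" "v \<in> insert z V" for u v
    using zv[OF that(1)] zv[OF that(2)] sym_rtrancl[OF sym]
    by (meson rtrancl_trans symD)
  ultimately show ?thesis
    by (auto simp: tree_on_def F add_root_def E'_def)
qed

text \<open>Without its first vertex \<open>z\<close>, a path from the new root is a path of
  \<open>F\<close> starting at an old root.\<close>

lemma ancestor_add_root: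
  assumes "is_ancestor (add_root z F) u v" "forest_on V F" "z \<notin> V"
  shows "v \<noteq> z \<and> (u = z \<or> is_ancestor F u v)"
proof -
  obtain E R where F: "F = (E, R)"
    by (cases F)
  note D = forest_onD[OF assms(2)[unfolded F]]
  define E' where "E' = fst (add_root z (E, R))"
  obtain xs where xs: "is_path E' z xs v" "u \<in> set xs" "u \<noteq> v"
    using assms(1) by (auto simp: is_ancestor_def add_root_def E'_def F)
  obtain ys where ys: "xs = z # ys"
    using xs(1) by (cases xs) (auto simp: is_path_def)
  have ne: "ys \<noteq> []"
    using xs by (auto simp: is_path_def ys)
  have y: "z \<notin> set ys" "distinct ys" "last ys = v" "(z, hd ys) \<in> E'"
      "successively (\<lambda>x y. (x, y) \<in> E') ys"
    using xs(1) ne by (auto simp: is_path_def ys successively_Cons)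
  have "hd ys \<in> R"
    using y(4) D(1,5) assms(3) by (auto simp: E'_def add_root_def)
  moreover have "is_path E (hd ys) ys v"
    using successively_add_root[of z E R ys] y ne by (simp add: is_path_def E'_def)
  moreover have "v \<noteq> z"
    using y(1,3) ne last_in_set by metis
  ultimately show ?thesis
    using xs by (auto simp: is_ancestor_def F ys)
qed

text \<open>The root \<open>z\<close> has no proper ancestor, so it can only be the first vertex of
  an instance. Being an extreme label, it would force the pattern to start with its minimum or
  maximum, whichever is excluded.\<close>

lemma avoids_on_add_root:
  assumes F: "forest_on V F" "avoids_on V F S" "z \<notin> V"
    and S: "\<forall>\<pi>\<in>S. is_pattern \<pi>"
    and "(\<forall>v\<in>V. z < v) \<and> (\<forall>\<pi>\<in>S. hd \<pi> \<noteq> 1) \<or>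
         (\<forall>v\<in>V. v < z) \<and> (\<forall>\<pi>\<in>S. hd \<pi> \<noteq> length \<pi>)"
  shows "avoids_on (insert z V) (add_root z F) S"
  unfolding avoids_on_def
proof (intro ballI notI)
  fix \<pi> assume \<pi>: "\<pi> \<in> S" and "\<exists>vs. instance_on (insert z V) (add_root z F) \<pi> vs"
  then obtain vs where vs: "instance_on (insert z V) (add_root z F) \<pi> vs"
    by blast
  have pat: "\<pi> \<noteq> []" "set \<pi> = {1..length \<pi>}"
    using S \<pi> by (auto simp: is_pattern_def)
  have len: "length vs = length \<pi>"
    and succ: "successively (is_ancestor (add_root z F)) vs"
    and sub: "set vs \<subseteq> insert z V"
    and order: "\<And>i j. i < length \<pi> \<Longrightarrow> j < length \<pi> \<Longrightarrow> vs ! i < vs ! j \<longleftrightarrow> \<pi> ! i < \<pi> ! j"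
    using vs by (auto simp: instance_on_def)
  obtain x xs where x: "vs = x # xs"
    using len pat by (cases vs) auto
  have anc: "v \<noteq> z" "u = z \<or> is_ancestor F u v" if "is_ancestor (add_root z F) u v" for u v
    using ancestor_add_root[OF that F(1,3)] by auto
  have "z \<notin> set xs"
  proof
    assume "z \<in> set xs"
    then obtain i where "i < length xs" "xs ! i = z"
      by (auto simp: in_set_conv_nth)
    \<comment> \<open>As \<open>vs = x # xs\<close>, the entry just before \<open>xs ! i\<close> is
      \<open>vs ! i\<close>.\<close>
    hence "is_ancestor (add_root z F) (vs ! i) z"
      using successively_nth[OF succ, of i] by (simp add: x)
    thus False
      using anc by blast
  qed
  show False
  proof (cases "x = z")
    case False
    have "successively (is_ancestor F) vs"
      by (rule successively_mono[OF succ]) (use anc False \<open>z \<notin> set xs\<close> in \<open>auto simp: x\<close>)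
    hence "instance_on V F \<pi> vs"
      using vs sub False \<open>z \<notin> set xs\<close> by (auto simp: instance_on_def x)
    thus False
      using F(2) \<pi> by (auto simp: avoids_on_def)
  next
    case True
    have rest: "vs ! j \<in> V" if "0 < j" "j < length \<pi>" for j
    proof -
      have "vs ! j = xs ! (j - 1)" "j - 1 < length xs"
        using that len by (auto simp: x nth_Cons')
      thus ?thesis
        using sub \<open>z \<notin> set xs\<close> by (metis insertE list.set_intros(2) nth_mem subsetD x)
    qed
    have hd: "hd \<pi> = \<pi> ! 0" "\<pi> ! 0 \<in> {1..length \<pi>}" "vs ! 0 = z"
      using pat True by (auto simp: hd_conv_nth x simp flip: pat(2))
    from assms(5) show False
    proof
      assume A: "(\<forall>v\<in>V. z < v) \<and> (\<forall>\<pi>\<in>S. hd \<pi> \<noteq> 1)"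
      \<comment> \<open>The position \<open>j\<close> of the minimum of \<open>\<pi>\<close> is not
        the first, yet the vertex there has a label above \<open>z\<close>; so
        \<open>\<pi> ! 0\<close> would lie below the minimum.\<close>
      have "1 \<in> set \<pi>"
        using pat by (auto simp: Suc_le_eq)
      then obtain j where j: "j < length \<pi>" "\<pi> ! j = 1"
        by (auto simp: in_set_conv_nth)
      hence "j \<noteq> 0"
        using A \<pi> hd(1) by metis
      hence "z < vs ! j"
        using A rest j by simp
      hence "\<pi> ! 0 < 1"
        using order[of 0 j] pat(1) j hd by simp
      thus False
        using hd by auto
    next
      assume A: "(\<forall>v\<in>V. v < z) \<and> (\<forall>\<pi>\<in>S. hd \<pi> \<noteq> length \<pi>)"
      have "length \<pi> \<in> set \<pi>"
        using pat by (auto simp: Suc_le_eq)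
      then obtain j where j: "j < length \<pi>" "\<pi> ! j = length \<pi>"
        by (auto simp: in_set_conv_nth)
      hence "j \<noteq> 0"
        using A \<pi> hd(1) by metis
      hence "vs ! j < z"
        using A rest j by simp
      hence "length \<pi> < \<pi> ! 0"
        using order[of j 0] pat(1) j hd by simp
      thus False
        using hd by auto
    qed
  qed
qed

text \<open>The forest is recovered by restricting the edges to \<open>V\<close> and taking the
  neighbours of \<open>z\<close> as roots.\<close>

lemma inj_on_add_root:
  assumes "z \<notin> V"
  shows "inj_on (add_root z) {F. forest_on V F}"
proof (rule inj_on_inverseI)
  fix F assume F: "F \<in> {F. forest_on V F}"
  obtain E R where FE: "F = (E, R)"
    by (cases F)
  have "E \<subseteq> V \<times> V" "R \<subseteq> V"
    using F forest_onD(1,5) by (auto simp: FE)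
  thus "(\<lambda>G. (fst G \<inter> V \<times> V, {r \<in> V. (z, r) \<in> fst G})) (add_root z F) = F"
    using assms by (auto simp: FE add_root_def)
qed

lemma num_forests_le_num_trees_Suc:
  assumes "\<forall>\<pi>\<in>S. is_pattern \<pi>"
    and "(\<forall>\<pi>\<in>S. hd \<pi> \<noteq> 1) \<or> (\<forall>\<pi>\<in>S. hd \<pi> \<noteq> length \<pi>)"
  shows "num_forests S n \<le> num_trees S (Suc n)"
proof -
  \<comment> \<open>The new root gets the label 1 if no pattern starts with its minimum, and the
    label \<open>Suc n\<close> otherwise.\<close>
  obtain z V where V: "finite V" "card V = n" "z \<notin> V" "insert z V = {1..Suc n}"
    and z: "(\<forall>v\<in>V. z < v) \<and> (\<forall>\<pi>\<in>S. hd \<pi> \<noteq> 1) \<or>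
            (\<forall>v\<in>V. v < z) \<and> (\<forall>\<pi>\<in>S. hd \<pi> \<noteq> length \<pi>)"
  proof (cases "\<forall>\<pi>\<in>S. hd \<pi> \<noteq> 1")
    case True
    show ?thesis
      by (rule that[of "{2..Suc n}" 1]) (use True in auto)
  next
    case False
    show ?thesis
      by (rule that[of "{1..n}" "Suc n"]) (use False assms(2) in auto)
  qed
  have "num_forests S n \<le> card (forests V S)"
    using num_le_card(1)[OF V(1), of S] V(2) by simp
  also have "\<dots> \<le> card (trees (insert z V) S)"
  proof (rule card_inj_on_le[of "add_root z"])
    show "inj_on (add_root z) (forests V S)"
      by (rule inj_on_subset[OF inj_on_add_root[OF V(3)]]) (auto simp: forests_def)
    show "add_root z ` forests V S \<subseteq> trees (insert z V) S"
      using tree_on_add_root avoids_on_add_root V(3) assms(1) z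
      by (auto simp: forests_def trees_def)
    show "finite (trees (insert z V) S)"
      using V(1) by (simp add: finite_trees)
  qed
  finally show ?thesis
    by (simp only: V(4) num_trees_eq)
qed

subsection \<open>Disjoint unions\<close>

definition join :: "nat rel \<times> nat set \<Rightarrow> nat rel \<times> nat set \<Rightarrow> nat rel \<times> nat set" where
  "join F G = (fst F \<union> fst G, snd F \<union> snd G)"

lemma join_commute: "join F G = join G F"
  by (simp add: join_def Un_commute)

text \<open>An edge at a vertex of \<open>V\<close> cannot come from \<open>E'\<close>, which lives
  on \<open>W\<close>; a walk from \<open>V\<close> thus never leaves \<open>V\<close> or
  \<open>E\<close>.\<close>

lemma rtrancl_Un_disjoint:
  assumes "(u, v) \<in> (E \<union> E')\<^sup>*" "u \<in> V" "E \<subseteq> V \<times> V" "E' \<subseteq> W \<times> W" "V \<inter> W = {}"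
  shows "v \<in> V \<and> (u, v) \<in> E\<^sup>*"
  using assms(1,2)
proof (induction rule: rtrancl_induct)
  case (step v w)
  hence "(v, w) \<in> E"
    using assms(3-5) by auto
  thus ?case
    using step assms(3) by (auto intro: rtrancl_into_rtrancl)
qed simp

lemma cycle_Un_disjoint:
  assumes "is_cycle (E \<union> E') xs" "hd xs \<in> V" "E \<subseteq> V \<times> V" "E' \<subseteq> W \<times> W" "V \<inter> W = {}"
  shows "is_cycle E xs"
proof -
  have ne: "xs \<noteq> []"
    using assms(1) by (auto simp: is_cycle_def)
  have "set xs \<subseteq> V \<and> successively (\<lambda>x y. (x, y) \<in> E) xs"
    by (rule successively_stays[of "\<lambda>x y. (x, y) \<in> E \<union> E'"])
       (use assms ne in \<open>auto simp: is_cycle_def\<close>)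
  thus ?thesis
    using assms ne unfolding is_cycle_def by auto
qed

lemma path_Un_disjoint:
  assumes "is_path (E \<union> E') u xs v" "u \<in> V" "E \<subseteq> V \<times> V" "E' \<subseteq> W \<times> W" "V \<inter> W = {}"
  shows "is_path E u xs v"
proof -
  have "set xs \<subseteq> V \<and> successively (\<lambda>x y. (x, y) \<in> E) xs"
    by (rule successively_stays[of "\<lambda>x y. (x, y) \<in> E \<union> E'"])
       (use assms in \<open>auto simp: is_path_def\<close>)
  thus ?thesis
    using assms unfolding is_path_def by auto
qed

lemma forest_on_join:
  assumes "forest_on V F" "forest_on W G" "V \<inter> W = {}"
  shows "forest_on (V \<union> W) (join F G)"
proof -
  obtain E R where F: "F = (E, R)"
    by (cases F)
  obtain E' R' where G: "G = (E', R')"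
    by (cases G)
  note D = forest_onD[OF assms(1)[unfolded F]]
  note D' = forest_onD[OF assms(2)[unfolded G]]
  have WV: "W \<inter> V = {}"
    using assms(3) by blast
  have sy: "sym (E \<union> E')"
    using D(2) D'(2) by (rule sym_Un)
  have "forest_on (V \<union> W) (E \<union> E', R \<union> R')"
  proof (rule forest_onI)
    show "irrefl (E \<union> E')"
      using D(3) D'(3) by (auto simp: irrefl_def)
    show "\<not> is_cycle (E \<union> E') xs" for xs
    proof
      assume cyc: "is_cycle (E \<union> E') xs"
      hence "xs \<noteq> []" "hd xs \<in> V \<or> hd xs \<in> W"
        using D(1) D'(1) by (auto simp: is_cycle_def)
      thus False
        using cycle_Un_disjoint[of E E' xs V W] cycle_Un_disjoint[of E' E xs W V]
          cyc D(1,4) D'(1,4) assms(3) WV by (auto simp: Un_commute)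
    qed
    show "\<exists>r\<in>R \<union> R'. (r, v) \<in> (E \<union> E')\<^sup>*" if "v \<in> V \<union> W" for v
      using that D(6) D'(6) rtrancl_mono[of E "E \<union> E'"] rtrancl_mono[of E' "E \<union> E'"] by blast
    show "r = s" if v: "v \<in> V \<union> W" and r: "r \<in> R \<union> R'" "s \<in> R \<union> R'"
      and rv: "(r, v) \<in> (E \<union> E')\<^sup>*" "(s, v) \<in> (E \<union> E')\<^sup>*" for r s v
    proof -
      \<comment> \<open>The walks are reversed to start at \<open>v\<close>, the vertex whose side
        is known.\<close>
      have vr: "(v, r) \<in> (E \<union> E')\<^sup>*" "(v, s) \<in> (E \<union> E')\<^sup>*"
        using rv sym_rtrancl[OF sy] by (auto dest: symD)
      note flip = symD[OF sym_rtrancl[OF D(2)]] symD[OF sym_rtrancl[OF D'(2)]]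
      show ?thesis
        using v
      proof
        assume "v \<in> V"
        hence "r \<in> V \<and> (v, r) \<in> E\<^sup>*" "s \<in> V \<and> (v, s) \<in> E\<^sup>*"
          using rtrancl_Un_disjoint[OF vr(1) \<open>v \<in> V\<close> D(1) D'(1) assms(3)]
            rtrancl_Un_disjoint[OF vr(2) \<open>v \<in> V\<close> D(1) D'(1) assms(3)] by auto
        moreover from this have "r \<in> R" "s \<in> R"
          using r D'(5) assms(3) by auto
        ultimately show ?thesis
          using D(7) \<open>v \<in> V\<close> flip by blast
      next
        assume "v \<in> W"
        hence "r \<in> W \<and> (v, r) \<in> E'\<^sup>*" "s \<in> W \<and> (v, s) \<in> E'\<^sup>*"
          using rtrancl_Un_disjoint[of v _ E' E W V] vr D(1) D'(1) WV by (auto simp: Un_commute)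
        moreover from this have "r \<in> R'" "s \<in> R'"
          using r D(5) assms(3) by auto
        ultimately show ?thesis
          using D'(7) \<open>v \<in> W\<close> flip by blast
      qed
    qed
  qed (use D D' sy in auto)
  thus ?thesis
    by (simp add: F G join_def)
qed

text \<open>The path witnessing the ancestor starts at a root. A root in \<open>W\<close> would
  confine the path to \<open>W\<close>, but the path contains \<open>u\<close>.\<close>

lemma ancestor_join:
  assumes "is_ancestor (join F G) u v" "u \<in> V" "forest_on V F" "forest_on W G" "V \<inter> W = {}"
  shows "v \<in> V \<and> is_ancestor F u v"
proof -
  obtain E R where F: "F = (E, R)"
    by (cases F)
  obtain E' R' where G: "G = (E', R')"
    by (cases G)
  note D = forest_onD[OF assms(3)[unfolded F]]
  note D' = forest_onD[OF assms(4)[unfolded G]]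
  obtain r xs where r: "r \<in> R \<union> R'" "is_path (E \<union> E') r xs v" "u \<in> set xs" "u \<noteq> v"
    using assms(1) by (auto simp: is_ancestor_def join_def F G)
  have "r \<in> R"
  proof (rule ccontr)
    assume "r \<notin> R"
    hence rW: "r \<in> W"
      using r(1) D'(5) by auto
    hence "is_path E' r xs v"
      using path_Un_disjoint[of E' E r xs v W V] r(2) D(1) D'(1) assms(5)
      by (auto simp: Un_commute Int_commute)
    hence "set xs \<subseteq> W"
      using rW D'(1) by (rule path_vertices)
    thus False
      using r(3) assms(2,5) by auto
  qed
  moreover from this have "is_path E r xs v"
    using path_Un_disjoint r(2) D(1,5) D'(1) assms(5) by blast
  ultimately have "is_ancestor F u v"
    using r by (auto simp: is_ancestor_def F)
  thus ?thesis
    using ancestor_vertices(2)[of E R u v V] D(1,5) by (simp add: F)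
qed

lemma instance_on_join:
  assumes "instance_on (V \<union> W) (join F G) \<pi> vs" "vs \<noteq> []" "hd vs \<in> V"
    and "forest_on V F" "forest_on W G" "V \<inter> W = {}"
  shows "instance_on V F \<pi> vs"
proof -
  have "set vs \<subseteq> V \<and> successively (is_ancestor F) vs"
    by (rule successively_stays[of "is_ancestor (join F G)"])
       (use assms ancestor_join in \<open>auto simp: instance_on_def\<close>)
  thus ?thesis
    using assms(1) by (auto simp: instance_on_def)
qed

text \<open>An instance is a chain of ancestors and stays in the half of its first vertex. The empty
  list is treated apart, having no first vertex.\<close>

lemma avoids_on_join:
  assumes "forest_on V F" "forest_on W G" "V \<inter> W = {}"
    and "avoids_on V F S" "avoids_on W G S"
  shows "avoids_on (V \<union> W) (join F G) S"
  unfolding avoids_on_def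
proof (intro ballI notI)
  fix \<pi> assume \<pi>: "\<pi> \<in> S" and "\<exists>vs. instance_on (V \<union> W) (join F G) \<pi> vs"
  then obtain vs where vs: "instance_on (V \<union> W) (join F G) \<pi> vs"
    by blast
  have "vs = [] \<or> vs \<noteq> [] \<and> hd vs \<in> V \<or> vs \<noteq> [] \<and> hd vs \<in> W"
    using vs by (cases vs) (auto simp: instance_on_def)
  moreover have "instance_on V F \<pi> vs" if "vs = []"
  proof -
    have "set vs \<subseteq> V" "successively (is_ancestor F) vs"
      using that by simp_all
    thus ?thesis
      using vs unfolding instance_on_def by blast
  qed
  moreover have "instance_on V F \<pi> vs" if "vs \<noteq> []" "hd vs \<in> V"
    using instance_on_join vs that assms by blast
  moreover have "instance_on W G \<pi> vs" if "vs \<noteq> []" "hd vs \<in> W"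
    using instance_on_join[of W V G F \<pi> vs] vs that assms
    by (simp add: Un_commute Int_commute join_commute)
  ultimately show False
    using \<pi> assms(4,5) by (auto simp: avoids_on_def)
qed

text \<open>The label set \<open>A\<close> is the component of \<open>a\<close>, and the two parts
  are restrictions to \<open>A\<close> and \<open>X - A\<close>. This makes the map from triples
  \<open>(A, F, G)\<close> to disjoint unions injective.\<close>

lemma join_determines:
  assumes "tree_on A F" "forest_on (X - A) G" "A \<subseteq> X" "a \<in> A"
  shows "A = {v. (a, v) \<in> (fst (join F G))\<^sup>*}"
    "F = (fst (join F G) \<inter> A \<times> A, snd (join F G) \<inter> A)"
    "G = (fst (join F G) \<inter> (X - A) \<times> (X - A), snd (join F G) \<inter> (X - A))"
proof -
  obtain E R where F: "F = (E, R)"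
    by (cases F)
  obtain E' R' where G: "G = (E', R')"
    by (cases G)
  have "forest_on A (E, R)"
    using assms(1) by (simp add: tree_on_def F)
  note D = forest_onD[OF this]
  note D' = forest_onD[OF assms(2)[unfolded G]]
  show "A = {v. (a, v) \<in> (fst (join F G))\<^sup>*}"
  proof (intro set_eqI iffI)
    fix v assume "v \<in> A"
    hence "(a, v) \<in> E\<^sup>*"
      using assms(1,4) by (simp add: tree_on_def F)
    thus "v \<in> {v. (a, v) \<in> (fst (join F G))\<^sup>*}"
      using rtrancl_mono[of E "E \<union> E'"] by (auto simp: join_def F G)
  next
    fix v assume "v \<in> {v. (a, v) \<in> (fst (join F G))\<^sup>*}"
    hence "(a, v) \<in> (E \<union> E')\<^sup>*"
      by (simp add: join_def F G)
    thus "v \<in> A"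
      using rtrancl_Un_disjoint[of a v E E' A "X - A"] assms(4) D(1) D'(1) by blast
  qed
  show "F = (fst (join F G) \<inter> A \<times> A, snd (join F G) \<inter> A)"
    using D(1,5) D'(1,5) by (auto simp: F G join_def)
  show "G = (fst (join F G) \<inter> (X - A) \<times> (X - A), snd (join F G) \<inter> (X - A))"
    using D(1,5) D'(1,5) by (auto simp: F G join_def)
qed

section \<open>Counting disjoint unions of two trees\<close>

lemma card_subsets_containing:
  assumes "finite X" "a \<in> X" "m \<ge> 1"
  shows "card {A. A \<subseteq> X \<and> a \<in> A \<and> card A = m} = (card X - 1) choose (m - 1)"
proof -
  have "bij_betw (insert a) {B. B \<subseteq> X - {a} \<and> card B = m - 1} {A. A \<subseteq> X \<and> a \<in> A \<and> card A = m}"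
  proof (rule bij_betw_byWitness[where f' = "\<lambda>A. A - {a}"])
    show "insert a ` {B. B \<subseteq> X - {a} \<and> card B = m - 1} \<subseteq> {A. A \<subseteq> X \<and> a \<in> A \<and> card A = m}"
    proof
      fix A assume "A \<in> insert a ` {B. B \<subseteq> X - {a} \<and> card B = m - 1}"
      then obtain B where B: "A = insert a B" "B \<subseteq> X - {a}" "card B = m - 1"
        by blast
      moreover have "finite B" "a \<notin> B"
        using B assms(1) by (auto intro: finite_subset)
      ultimately show "A \<in> {A. A \<subseteq> X \<and> a \<in> A \<and> card A = m}"
        using assms by auto
    qed
  qed (auto simp: insert_absorb)
  hence "card {A. A \<subseteq> X \<and> a \<in> A \<and> card A = m} = card {B. B \<subseteq> X - {a} \<and> card B = m - 1}"
    by (rule bij_betw_same_card[symmetric])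
  also have "\<dots> = (card X - 1) choose (m - 1)"
    using n_subsets[of "X - {a}" "m - 1"] assms by simp
  finally show ?thesis .
qed

text \<open>The binomial coefficient counts the label sets \<open>A\<close> of size \<open>m\<close>
  that contain 1. Requiring 1 in \<open>A\<close> singles out one of the two trees, so that no
  forest is produced twice.\<close>

lemma num_forests_ge_joins:
  assumes "m \<ge> 1" "n \<ge> 1"
  shows "((m + n - 1) choose (m - 1)) * (num_trees S m * num_trees S n) \<le> num_forests S (m + n)"
proof -
  define X where "X = {1..m + n}"
  define \<A> where "\<A> = {A. A \<subseteq> X \<and> 1 \<in> A \<and> card A = m}"
  define P where "P = (SIGMA A:\<A>. trees A S \<times> trees (X - A) S)"
  have X: "finite X" "card X = m + n" "1 \<in> X"
    using assms by (auto simp: X_def)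
  have fin: "finite \<A>" "\<And>A. A \<in> \<A> \<Longrightarrow> finite A"
    using X(1) by (auto simp: \<A>_def intro: finite_subset)
  have "((m + n - 1) choose (m - 1)) * (num_trees S m * num_trees S n)
      = (\<Sum>A\<in>\<A>. num_trees S m * num_trees S n)"
    using card_subsets_containing[OF X(1,3) assms(1)] by (simp add: \<A>_def X(2))
  also have "\<dots> \<le> (\<Sum>A\<in>\<A>. card (trees A S \<times> trees (X - A) S))"
  proof (rule sum_mono)
    fix A assume A: "A \<in> \<A>"
    hence "card A = m" "card (X - A) = n"
      using X fin(2)[OF A] by (auto simp: \<A>_def card_Diff_subset)
    thus "num_trees S m * num_trees S n \<le> card (trees A S \<times> trees (X - A) S)"
      using num_le_card(2)[of A S] num_le_card(2)[of "X - A" S] fin(2)[OF A] X(1)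
      by (auto simp: card_cartesian_product intro: mult_le_mono)
  qed
  also have "\<dots> = card P"
    unfolding P_def using fin X(1) by (subst card_SigmaI) (auto intro!: finite_trees)
  also have "\<dots> \<le> card (forests X S)"
  proof (rule card_inj_on_le[of "\<lambda>(A, F, G). join F G"])
    have det: "A = {v. (1, v) \<in> (fst (join F G))\<^sup>*}"
      "F = (fst (join F G) \<inter> A \<times> A, snd (join F G) \<inter> A)"
      "G = (fst (join F G) \<inter> (X - A) \<times> (X - A), snd (join F G) \<inter> (X - A))"
      if "(A, F, G) \<in> P" for A F G
    proof -
      have "tree_on A F" "forest_on (X - A) G" "A \<subseteq> X" "1 \<in> A"
        using that by (auto simp: P_def \<A>_def trees_def tree_on_def)
      thus "A = {v. (1, v) \<in> (fst (join F G))\<^sup>*}"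
        "F = (fst (join F G) \<inter> A \<times> A, snd (join F G) \<inter> A)"
        "G = (fst (join F G) \<inter> (X - A) \<times> (X - A), snd (join F G) \<inter> (X - A))"
        by (rule join_determines)+
    qed
    show "inj_on (\<lambda>(A, F, G). join F G) P"
    proof (rule inj_onI)
      fix p q
      assume pq: "p \<in> P" "q \<in> P"
        "(case p of (A, F, G) \<Rightarrow> join F G) = (case q of (A, F, G) \<Rightarrow> join F G)"
      obtain A F G where p: "p = (A, F, G)"
        by (rule prod_cases3)
      obtain A' F' G' where q: "q = (A', F', G')"
        by (rule prod_cases3)
      have PP: "(A, F, G) \<in> P" "(A', F', G') \<in> P" and eq: "join F G = join F' G'"
        using pq by (simp_all add: p q)
      have A: "A = A'"
        using det(1)[OF PP(1)] det(1)[OF PP(2)] unfolding eq by simp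
      have "F = F'"
        using det(2)[OF PP(1)] det(2)[OF PP(2)] unfolding eq A by simp
      moreover have "G = G'"
        using det(3)[OF PP(1)] det(3)[OF PP(2)] unfolding eq A by simp
      ultimately show "p = q"
        using A by (simp add: p q)
    qed
    show "(\<lambda>(A, F, G). join F G) ` P \<subseteq> forests X S"
    proof (rule image_subsetI)
      fix p assume "p \<in> P"
      obtain A F G where p: "p = (A, F, G)"
        by (rule prod_cases3)
      have *: "forest_on A F" "forest_on (X - A) G" "avoids_on A F S" "avoids_on (X - A) G S"
        "A \<subseteq> X"
        using \<open>p \<in> P\<close> by (auto simp: p P_def \<A>_def trees_def tree_on_def)
      have "A \<union> (X - A) = X" "A \<inter> (X - A) = {}"
        using *(5) by auto
      thus "(case p of (A, F, G) \<Rightarrow> join F G) \<in> forests X S"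
        using forest_on_join[OF *(1,2)] avoids_on_join[OF *(1,2) _ *(3,4)]
        by (simp add: forests_def p)
    qed
    show "finite (forests X S)"
      using X(1) by (rule finite_forests)
  qed
  finally show ?thesis
    by (simp add: num_forests_eq X_def)
qed

text \<open>The label 1 may lie in the tree of size \<open>m\<close> or in the one of size
  \<open>n\<close>. For \<open>m = n\<close> these are the same forests, so each family is bounded
  by all forests separately; adding the two bounds costs the factor 2.\<close>

lemma num_trees_supermultiplicative:
  assumes "m \<ge> 1" "n \<ge> 1"
  shows "((m + n) choose m) * num_trees S m * num_trees S n \<le> 2 * num_forests S (m + n)"
proof -
  define t where "t = num_trees S m * num_trees S n"
  define f where "f = num_forests S (m + n)"
  \<comment> \<open>Absorption of \<open>m\<close> into the binomial coefficient. The sum with the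
    same inequality for \<open>n\<close> has the common factor \<open>m + n\<close>, which
    cancels.\<close>
  have "m * ((m + n) choose m) * t = (m + n) * (((m + n - 1) choose (m - 1)) * t)"
    using times_binomial_minus1_eq[of m "m + n"] assms by simp
  also have "\<dots> \<le> (m + n) * f"
    using num_forests_ge_joins[OF assms, of S] by (intro mult_le_mono) (simp_all add: t_def f_def)
  finally have 1: "m * ((m + n) choose m) * t \<le> (m + n) * f" .
  have "(m + n) choose m = (m + n) choose n"
    using binomial_symmetric[of m "m + n"] by simp
  hence "n * ((m + n) choose m) * t = (m + n) * (((m + n - 1) choose (n - 1)) * t)"
    using times_binomial_minus1_eq[of n "m + n"] assms by simp
  also have "\<dots> \<le> (m + n) * f"
    using num_forests_ge_joins[OF assms(2,1), of S]
    by (intro mult_le_mono) (simp_all add: t_def f_def ac_simps)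
  finally have 2: "n * ((m + n) choose m) * t \<le> (m + n) * f" .
  have "(m + n) * (((m + n) choose m) * t) \<le> (m + n) * (2 * f)"
    using 1 2 by (simp add: algebra_simps)
  thus ?thesis
    using assms by (simp add: t_def f_def mult.assoc)
qed

subsection \<open>An upper bound on the number of forests\<close>

text \<open>The first vertex \<open>v\<close> of a longest path works: by maximality its neighbours
  lie on the path, and any neighbour other than the next vertex would close a cycle.\<close>

lemma acyclic_graph_leaf:
  assumes "finite V" "V \<noteq> {}" "E \<subseteq> V \<times> V" "sym E" "irrefl E" "\<And>xs. \<not> is_cycle E xs"
  obtains v u where "v \<in> V" "\<And>w. (v, w) \<in> E \<Longrightarrow> w = u"
proof -
  define P where "P xs \<longleftrightarrow> xs \<noteq> [] \<and> set xs \<subseteq> V \<and> distinct xs \<and> successively (\<lambda>x y. (x, y) \<in> E) xs"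
    for xs
  obtain v0 where "v0 \<in> V"
    using assms(2) by blast
  hence "P [v0]"
    by (simp add: P_def)
  moreover have "\<forall>xs. P xs \<longrightarrow> length xs < Suc (card V)"
    using assms(1) by (metis P_def card_mono distinct_card less_Suc_eq_le)
  ultimately have "\<exists>xs. P xs \<and> (\<forall>ys. P ys \<longrightarrow> length ys \<le> length xs)"
    by (rule Lattices_Big.ex_has_greatest_nat)
  then obtain xs where xs: "P xs" and max: "\<And>ys. P ys \<Longrightarrow> length ys \<le> length xs"
    by blast
  obtain v ys where v: "xs = v # ys"
    using xs by (cases xs) (auto simp: P_def)
  have nbr: "w \<in> set ys" if "(v, w) \<in> E" for w
  proof (rule ccontr)
    assume "w \<notin> set ys"
    moreover have "w \<noteq> v" "w \<in> V" "(w, v) \<in> E"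
      using that assms(3-5) by (auto simp: irrefl_def dest: symD)
    ultimately have "P (w # xs)"
      using xs by (simp add: P_def v)
    thus False
      using max by fastforce
  qed
  have "w = hd ys" if w: "(v, w) \<in> E" for w
  proof (rule ccontr)
    assume ne: "w \<noteq> hd ys"
    obtain as bs where ys: "ys = as @ w # bs"
      using nbr[OF w] by (meson split_list)
    hence "as \<noteq> []"
      using ne by auto
    hence "is_cycle E (v # as @ [w])"
      using xs w assms(4) by (auto simp: is_cycle_def P_def v ys successively_Cons
          successively_append_iff Suc_le_eq dest: symD)
    thus False
      using assms(6) by blast
  qed
  \<comment> \<open>If \<open>ys\<close> is empty, \<open>hd ys\<close> is unspecified, but then
    \<open>v\<close> has no neighbour at all.\<close>
  thus ?thesis
    using xs that[of v "hd ys"] by (auto simp: P_def v)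
qed

text \<open>Encodes each edge at one of its endpoints: \<open>p\<close> points from a vertex to a
  neighbour, and a value outside \<open>V\<close> means that no edge is recorded there.\<close>

definition graph_of_fun :: "nat set \<Rightarrow> (nat \<Rightarrow> nat) \<Rightarrow> nat rel" where
  "graph_of_fun V p = {(u, v). u \<in> V \<and> v \<in> V \<and> (p v = u \<or> p u = v)}"

text \<open>Leaves are removed one by one. When \<open>v\<close> is removed it has at most one edge
  left, which the single value \<open>p v\<close> can record; \<open>z\<close> stands for
  none.\<close>

lemma acyclic_graph_of_fun:
  assumes "finite V" "z \<notin> V" "E \<subseteq> V \<times> V" "sym E" "irrefl E" "\<And>xs. \<not> is_cycle E xs"
  shows "\<exists>p \<in> V \<rightarrow>\<^sub>E insert z V. E = graph_of_fun V p"
  using assms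
proof (induction V arbitrary: E rule: finite_psubset_induct)
  case (psubset V)
  show ?case
  proof (cases "V = {}")
    case True
    thus ?thesis
      using psubset.prems by (auto simp: graph_of_fun_def)
  next
    case False
    obtain v u where v: "v \<in> V" "\<And>w. (v, w) \<in> E \<Longrightarrow> w = u"
      using acyclic_graph_leaf[OF psubset.hyps(1) False psubset.prems(2-5)] by blast
    define V' where "V' = V - {v}"
    define E' where "E' = E \<inter> V' \<times> V'"
    have "\<exists>p \<in> V' \<rightarrow>\<^sub>E insert z V'. E' = graph_of_fun V' p"
    proof (rule psubset.IH)
      show "\<not> is_cycle E' xs" for xs
      proof
        assume "is_cycle E' xs"
        hence "is_cycle E xs"
          unfolding is_cycle_def E'_def by (auto elim: successively_mono)
        thus False
          using psubset.prems by blast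
      qed
      show "sym E'"
        using psubset.prems(3) by (auto simp: E'_def sym_def)
    qed (use v psubset.prems in \<open>auto simp: V'_def E'_def irrefl_def\<close>)
    then obtain p where p: "p \<in> V' \<rightarrow>\<^sub>E insert z V'" "E' = graph_of_fun V' p"
      by blast
    define q where "q = p(v := if \<exists>w. (v, w) \<in> E then u else z)"
    have qv: "q v = w \<longleftrightarrow> (v, w) \<in> E" if "w \<in> V" for w
      using v(2) that psubset.prems(1) by (auto simp: q_def)
    have q_other: "q w = p w" "q w \<noteq> v" if "w \<in> V'" for w
      using that p(1) psubset.prems(1) v(1) by (auto simp: q_def V'_def PiE_iff)
    \<comment> \<open>No vertex points to \<open>v\<close>, so the edges at \<open>v\<close> are
      exactly those given by \<open>q v\<close>.\<close>
    have q_ne: "q w \<noteq> v" if "w \<in> V" for w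
    proof (cases "w = v")
      case True
      thus ?thesis
        using qv[of v] v(1) psubset.prems(4) by (simp add: irrefl_def)
    qed (use that q_other in \<open>simp add: V'_def\<close>)
    have "(a, b) \<in> E \<longleftrightarrow> (a, b) \<in> graph_of_fun V q" for a b
    proof (cases "a \<in> V \<and> b \<in> V")
      case True
      show ?thesis
      proof (cases "a = v \<or> b = v")
        case False
        hence ab: "a \<in> V'" "b \<in> V'"
          using True by (auto simp: V'_def)
        have "(a, b) \<in> E \<longleftrightarrow> (a, b) \<in> graph_of_fun V' p"
          using ab by (simp add: E'_def flip: p(2))
        thus ?thesis
          using ab True q_other by (simp add: graph_of_fun_def)
      next
        case av: True
        have "(a, b) \<in> E \<longleftrightarrow> (b, a) \<in> E"
          using psubset.prems(3) by (auto dest: symD)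
        thus ?thesis
          using av True qv q_ne by (auto simp: graph_of_fun_def)
      qed
    qed (use psubset.prems(2) in \<open>auto simp: graph_of_fun_def\<close>)
    hence "E = graph_of_fun V q"
      by auto
    moreover have "q \<in> V \<rightarrow>\<^sub>E insert z V"
    proof -
      have "u \<in> V" if "(v, w) \<in> E" for w
        using that v(2)[OF that] psubset.prems(2) by auto
      thus ?thesis
        using p(1) v(1) by (auto simp: q_def V'_def PiE_iff extensional_def)
    qed
    ultimately show ?thesis
      by blast
  qed
qed

text \<open>The powers bound the choices of the root set and of the encoding function. The value 0
  is free to mean "no edge" because labels start at 1.\<close>

lemma num_forests_le: "num_forests S n \<le> 2 ^ n * Suc n ^ n"
proof -
  define V where "V = {1..n}"
  define G where "G = graph_of_fun V ` (V \<rightarrow>\<^sub>E insert 0 V)"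
  have fin: "finite (V \<rightarrow>\<^sub>E insert 0 V)"
    by (intro finite_PiE) (auto simp: V_def)
  have "forests V S \<subseteq> G \<times> Pow V"
  proof
    fix F assume "F \<in> forests V S"
    hence "forest_on V (fst F, snd F)"
      by (simp add: forests_def)
    note D = forest_onD[OF this]
    have "\<exists>p \<in> V \<rightarrow>\<^sub>E insert 0 V. fst F = graph_of_fun V p"
      by (rule acyclic_graph_of_fun[OF _ _ D(1-4)]) (auto simp: V_def)
    thus "F \<in> G \<times> Pow V"
      using D(5) by (auto simp: G_def mem_Times_iff)
  qed
  hence "card (forests V S) \<le> card (G \<times> Pow V)"
    using fin by (intro card_mono) (auto simp: G_def V_def)
  also have "\<dots> = card G * 2 ^ n"
    by (simp add: card_cartesian_product card_Pow V_def)
  also have "\<dots> \<le> card (V \<rightarrow>\<^sub>E insert 0 V) * 2 ^ n"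
    unfolding G_def using fin by (intro mult_le_mono card_image_le) auto
  also have "card (V \<rightarrow>\<^sub>E insert 0 V) = Suc n ^ n"
    by (simp add: card_funcsetE V_def)
  finally show ?thesis
    by (simp add: num_forests_eq V_def mult.commute)
qed

subsection \<open>Growth of factorials\<close>

lemma succ_power_le_exp:
  assumes "n \<ge> 1"
  shows "(real n + 1) ^ n \<le> exp 1 * real n ^ n"
proof -
  have "(1 + 1 / real n) ^ n \<le> exp 1"
    using assms by (intro exp_ge_one_plus_x_over_n_power_n) auto
  moreover have "1 + 1 / real n = (real n + 1) / real n"
    using assms by (simp add: field_simps)
  ultimately show ?thesis
    using assms by (simp add: power_divide field_simps)
qed

text \<open>This is (1 - 1/(n+1))^(n+1) \<le> 1/e with the denominators cleared.\<close>

lemma exp_le_succ_power: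
  assumes "n \<ge> 1"
  shows "exp 1 * real n ^ Suc n \<le> (real n + 1) ^ Suc n"
proof -
  have "(1 + (-1) / real (Suc n)) ^ Suc n \<le> exp (-1)"
    by (intro exp_ge_one_plus_x_over_n_power_n) auto
  moreover have "1 + (-1) / real (Suc n) = real n / (real n + 1)"
    by (simp add: field_simps)
  ultimately have "real n ^ Suc n / (real n + 1) ^ Suc n \<le> exp (-1)"
    by (simp only: power_divide)
  hence "real n ^ Suc n \<le> exp (-1) * (real n + 1) ^ Suc n"
    by (simp add: divide_le_eq del: power_Suc)
  hence "exp 1 * real n ^ Suc n \<le> exp 1 * (exp (-1) * (real n + 1) ^ Suc n)"
    by (intro mult_left_mono) auto
  thus ?thesis
    by (simp only: mult.assoc[symmetric] exp_add[symmetric]) simp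
qed

text \<open>Half of a weak Stirling formula, n! \<ge> (n/e)^n: the step from n to n + 1 multiplies
  n^n by (n+1)(1+1/n)^n, which is at most (n+1)e.\<close>

lemma power_le_fact_exp: "real n ^ n \<le> fact n * exp (real n)"
proof (induction n)
  case (Suc n)
  show ?case
  proof (cases "n = 0")
    case False
    have "real (Suc n) ^ Suc n = real (Suc n) * (real n + 1) ^ n"
      by (simp add: add.commute)
    also have "\<dots> \<le> real (Suc n) * (exp 1 * real n ^ n)"
      using succ_power_le_exp[of n] False by (intro mult_left_mono) auto
    also have "\<dots> \<le> real (Suc n) * (exp 1 * (fact n * exp (real n)))"
      using Suc.IH by (intro mult_left_mono) auto
    also have "\<dots> = fact (Suc n) * exp (real (Suc n))"
      by (simp add: exp_add algebra_simps)
    finally show ?thesis .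
  qed simp
qed simp

text \<open>The other half, n! \<le> e n (n/e)^n, with a polynomial loss that disappears under the
  n-th root.\<close>

lemma fact_exp_le_power:
  assumes "n \<ge> 1"
  shows "fact n * exp (real n) \<le> exp 1 * real n * real n ^ n"
  using assms
proof (induction n rule: dec_induct)
  case (step n)
  have "fact (Suc n) * exp (real (Suc n)) = real (Suc n) * exp 1 * (fact n * exp (real n))"
    by (simp add: exp_add algebra_simps)
  also have "\<dots> \<le> real (Suc n) * exp 1 * (exp 1 * real n * real n ^ n)"
    using step by (intro mult_left_mono) auto
  also have "\<dots> = real (Suc n) * exp 1 * (exp 1 * real n ^ Suc n)"
    by simp
  also have "\<dots> \<le> real (Suc n) * exp 1 * (real n + 1) ^ Suc n"
    using step exp_le_succ_power[of n] by (intro mult_left_mono) auto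
  also have "\<dots> = exp 1 * real (Suc n) * real (Suc n) ^ Suc n"
    by (simp add: add.commute)
  finally show ?case .
qed simp

lemma root_fact_over_n: "(\<lambda>n. root n (fact n) / real n) \<longlonglongrightarrow> exp (-1)"
proof (rule tendsto_sandwich)
  have lim: "(\<lambda>n::nat. (exp 1 * real n) powr (1 / real n)) \<longlonglongrightarrow> 1"
    by real_asymp
  show "(\<lambda>n. exp (-1 :: real)) \<longlonglongrightarrow> exp (-1)"
    by simp
  show "(\<lambda>n. exp (-1) * (exp 1 * real n) powr (1 / real n)) \<longlonglongrightarrow> exp (-1)"
    using tendsto_mult_left[OF lim, of "exp (-1)"] by simp
  have root_pow: "root n (real n ^ n / exp (real n)) = real n * exp (-1)" if "n \<ge> 1" for n
  proof -
    have "real n ^ n / exp (real n) = (real n * exp (-1)) ^ n"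
      by (simp add: power_mult_distrib exp_of_nat_mult[symmetric] exp_minus field_simps)
    thus ?thesis
      using that by (simp add: real_root_power_cancel)
  qed
  show "\<forall>\<^sub>F n in sequentially. exp (-1 :: real) \<le> root n (fact n) / real n"
    using eventually_ge_at_top[of 1]
  proof eventually_elim
    case (elim n)
    have "real n ^ n / exp (real n) \<le> fact n"
      using power_le_fact_exp[of n] by (simp add: divide_le_eq)
    hence "root n (real n ^ n / exp (real n)) \<le> root n (fact n)"
      using elim by (intro real_root_le_mono) auto
    thus ?case
      using elim root_pow[of n] by (simp add: field_simps)
  qed
  show "\<forall>\<^sub>F n in sequentially. root n (fact n) / real n \<le>
          exp (-1) * (exp 1 * real n) powr (1 / real n)"
    using eventually_ge_at_top[of 1]
  proof eventually_elim
    case (elim n)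
    have "fact n \<le> (exp 1 * real n) * (real n ^ n / exp (real n))"
      using fact_exp_le_power[of n] elim by (simp add: field_simps)
    hence "root n (fact n) \<le> root n ((exp 1 * real n) * (real n ^ n / exp (real n)))"
      using elim by (intro real_root_le_mono) auto
    also have "\<dots> = root n (exp 1 * real n) * (real n * exp (-1))"
      by (subst real_root_mult) (use root_pow[of n] elim in simp)
    also have "root n (exp 1 * real n) = (exp 1 * real n) powr (1 / real n)"
      using elim by (simp add: root_powr_inverse)
    finally show ?case
      using elim by (simp add: field_simps)
  qed
qed

section \<open>Shifting the index under the root\<close>

text \<open>The n-th root of \<open>u (Suc n)\<close> is its (n+1)-st root raised to (n+1)/n. This
  exponent tends to 1, and (n+1)^((n+1)/n) / n tends to 1 as well.\<close>

lemma root_shift: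
  fixes u :: "nat \<Rightarrow> real"
  assumes lim: "(\<lambda>n. root n (u n) / real n) \<longlonglongrightarrow> L" and nonneg: "\<And>n. u n \<ge> 0"
  shows "(\<lambda>n. root n (u (Suc n)) / real n) \<longlonglongrightarrow> L"
proof -
  define z where "z n = root n (u n) / real n" for n
  have "(\<lambda>n. z (Suc n)) \<longlonglongrightarrow> L"
    using lim unfolding z_def by (rule LIMSEQ_Suc)
  moreover have "(\<lambda>n::nat. (real n + 1) / real n) \<longlonglongrightarrow> 1"
    by real_asymp
  ultimately have "(\<lambda>n. z (Suc n) powr ((real n + 1) / real n)) \<longlonglongrightarrow> L powr 1"
    by (rule tendsto_powr2) (auto simp: z_def nonneg)
  moreover have "(\<lambda>n::nat. (real n + 1) powr ((real n + 1) / real n) / real n) \<longlonglongrightarrow> 1"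
    by real_asymp
  ultimately have "(\<lambda>n. z (Suc n) powr ((real n + 1) / real n) *
      ((real n + 1) powr ((real n + 1) / real n) / real n)) \<longlonglongrightarrow> L powr 1 * 1"
    by (rule tendsto_mult)
  \<comment> \<open>Needed for \<open>L powr 1 = L\<close>.\<close>
  moreover have "L \<ge> 0"
    by (rule tendsto_lowerbound[OF lim]) (auto simp: nonneg real_root_pos_pos_le intro!: always_eventually divide_nonneg_nonneg)
  moreover have "\<forall>\<^sub>F n in sequentially. z (Suc n) powr ((real n + 1) / real n) *
      ((real n + 1) powr ((real n + 1) / real n) / real n) = root n (u (Suc n)) / real n"
    using eventually_ge_at_top[of 1]
  proof eventually_elim
    case (elim n)
    have "z (Suc n) powr ((real n + 1) / real n) * (real n + 1) powr ((real n + 1) / real n)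
        = (z (Suc n) * (real n + 1)) powr ((real n + 1) / real n)"
      by (subst powr_mult) (auto simp: z_def nonneg)
    also have "z (Suc n) * (real n + 1) = u (Suc n) powr (1 / (real n + 1))"
      by (simp add: z_def root_powr_inverse nonneg add.commute)
    also have "\<dots> powr ((real n + 1) / real n) = root n (u (Suc n))"
      using elim by (simp add: powr_powr root_powr_inverse nonneg)
    finally show ?case
      by simp
  qed
  ultimately show ?thesis
    using Lim_transform_eventually by fastforce
qed

subsection \<open>Almost supermultiplicative sequences\<close>

text \<open>
  The induction splits \<open>q\<close> in half. The weight \<open>q\<^sup>2\<close> absorbs the factor \<open>2 (m + n)\<close> lost in
  every splitting; \<open>41\<close> exceeds \<open>2 (9/2)\<^sup>2\<close>, where \<open>a b \<ge> (2/9) (a + b)\<^sup>2\<close> for the two halves.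
\<close>

lemma almost_supermultiplicative_multiple:
  fixes A :: "nat \<Rightarrow> real"
  assumes nonneg: "\<And>n. A n \<ge> 0"
    and super: "\<And>m n. m \<ge> 1 \<Longrightarrow> n \<ge> 1 \<Longrightarrow> A m * A n \<le> 2 * real (m + n) * A (m + n)"
    and "M \<ge> 1" "q \<ge> 1"
  shows "(real q)\<^sup>2 * (41 * real M) * (A M / (41 * real M)) ^ q \<le> A (q * M)"
  using \<open>q \<ge> 1\<close>
proof (induction q rule: less_induct)
  case (less q)
  define y where "y = A M / (41 * real M)"
  have y: "y \<ge> 0"
    using nonneg by (simp add: y_def)
  show ?case
  proof (cases "q = 1")
    case True
    thus ?thesis
      using \<open>M \<ge> 1\<close> by simp
  next
    case False
    define a b where "a = q div 2" and "b = q - q div 2"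
    have ab: "q = a + b" "a \<ge> 1" "b \<ge> 1" "a < q" "b < q" "b = a \<or> b = a + 1"
      using less.prems False unfolding a_def b_def by linarith+
    \<comment> \<open>Sharp for \<open>q = 3\<close>, where the halves are 1 and 2.\<close>
    have "2 * q\<^sup>2 \<le> 9 * (a * b)"
      using ab(6)
    proof
      assume "b = a"
      thus ?thesis
        by (simp add: ab(1) power2_eq_square algebra_simps)
    next
      assume b: "b = a + 1"
      have "2 \<le> a + a * a"
        using ab(2) mult_le_mono[OF ab(2) ab(2)] by linarith
      thus ?thesis
        by (simp add: b ab(1) power2_eq_square algebra_simps)
    qed
    hence "(2 * q\<^sup>2)\<^sup>2 \<le> (9 * (a * b))\<^sup>2"
      by (rule power_mono) simp
    hence "4 * q ^ 4 \<le> 81 * (a * b)\<^sup>2"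
      by (simp add: power_mult_distrib)
    hence "2 * q ^ 4 \<le> 41 * (a * b)\<^sup>2"
      by linarith
    moreover have "q ^ 3 \<le> q ^ 4"
      using less.prems by (intro power_increasing) auto
    ultimately have "2 * q ^ 3 \<le> 41 * (a * b)\<^sup>2"
      by linarith
    hence ineq: "2 * real q ^ 3 \<le> 41 * (real a * real b)\<^sup>2"
      by (metis (mono_tags, lifting) of_nat_le_iff of_nat_mult of_nat_numeral of_nat_power)
    \<comment> \<open>Both sides carry the factor \<open>2 * q * M\<close> that the last splitting
      costs; it cancels at the end. Together with the weight it accounts for the cube of
      \<open>q\<close>.\<close>
    have "2 * real q * real M * ((real q)\<^sup>2 * (41 * real M) * y ^ q) =
        (2 * real q ^ 3) * (41 * (real M)\<^sup>2 * y ^ q)"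
      by (simp add: power2_eq_square power3_eq_cube)
    also have "\<dots> \<le> (41 * (real a * real b)\<^sup>2) * (41 * (real M)\<^sup>2 * y ^ q)"
      using y by (intro mult_right_mono ineq) auto
    also have "\<dots> = ((real a)\<^sup>2 * (41 * real M) * y ^ a) * ((real b)\<^sup>2 * (41 * real M) * y ^ b)"
      by (simp add: ab(1) power2_eq_square power_add)
    also have "\<dots> \<le> A (a * M) * A (b * M)"
      using less.IH[of a] less.IH[of b] ab y nonneg unfolding y_def[symmetric]
      by (intro mult_mono) auto
    also have "\<dots> \<le> 2 * real (a * M + b * M) * A (a * M + b * M)"
      using ab \<open>M \<ge> 1\<close> by (intro super) auto
    also have "\<dots> = 2 * real q * real M * A (q * M)"
      by (simp add: ab(1) algebra_simps)
    finally show ?thesis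
      using less.prems \<open>M \<ge> 1\<close> unfolding y_def[symmetric] by (simp add: ac_simps)
  qed
qed

text \<open>Bridges the gap from a multiple of \<open>M\<close> to an arbitrary index. With fewer
  than \<open>M\<close> steps the loss is polynomial of bounded degree.\<close>

lemma quasi_mono_interpolate:
  fixes A :: "nat \<Rightarrow> real"
  assumes nonneg: "\<And>n. A n \<ge> 0"
    and step: "\<And>n. n \<ge> 1 \<Longrightarrow> A n \<le> real n * A (Suc n)"
    and "n \<ge> 1"
  shows "A n \<le> real (n + k) ^ k * A (n + k)"
proof (induction k)
  case (Suc k)
  have "A n \<le> real (n + k) ^ k * A (n + k)"
    by (rule Suc.IH)
  also have "\<dots> \<le> real (n + k) ^ k * (real (n + k) * A (Suc (n + k)))"
    using \<open>n \<ge> 1\<close> by (intro mult_left_mono step) auto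
  also have "\<dots> = real (n + k) ^ Suc k * A (n + Suc k)"
    by simp
  also have "\<dots> \<le> real (n + Suc k) ^ Suc k * A (n + Suc k)"
    by (intro mult_right_mono power_mono nonneg) auto
  finally show ?case .
qed simp

text \<open>The limit is the supremum \<open>L\<close> of the roots of
  \<open>A M / (41 * M)\<close>. Each of these is an asymptotic lower bound, by passing to multiples
  of \<open>M\<close>. The upper bound holds because (41 N)^(1/N) tends to 1.\<close>

lemma almost_supermultiplicative_root_converges:
  fixes A :: "nat \<Rightarrow> real"
  assumes nonneg: "\<And>n. A n \<ge> 0"
    and super: "\<And>m n. m \<ge> 1 \<Longrightarrow> n \<ge> 1 \<Longrightarrow> A m * A n \<le> 2 * real (m + n) * A (m + n)"
    and step: "\<And>n. n \<ge> 1 \<Longrightarrow> A n \<le> real n * A (Suc n)"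
    and bound: "\<And>n. n \<ge> 1 \<Longrightarrow> A n \<le> C ^ n" and "C \<ge> 0"
  shows "\<exists>L. (\<lambda>n. root n (A n)) \<longlonglongrightarrow> L"
proof -
  define y where "y M = A M / (41 * real M)" for M
  define g where "g M = root M (y M)" for M
  define L where "L = Sup (g ` {1..})"
  have y: "y M \<ge> 0" for M
    using nonneg by (simp add: y_def)
  have "g M \<le> C" if "M \<ge> 1" for M
  proof -
    have "A M * 1 \<le> A M * (41 * real M)"
      using that nonneg[of M] by (intro mult_left_mono) auto
    hence "y M \<le> A M"
      using that by (simp add: y_def divide_le_eq)
    also have "\<dots> \<le> C ^ M"
      using that by (rule bound)
    finally show ?thesis
      using that \<open>C \<ge> 0\<close> unfolding g_def by (metis less_le_trans real_root_le_iff real_root_power_cancel zero_less_one)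
  qed
  hence bdd: "bdd_above (g ` {1..})"
    by (intro bdd_aboveI[of _ C]) auto
  have g_le: "g M \<le> L" if "M \<ge> 1" for M
    unfolding L_def using that bdd by (intro cSup_upper) auto
  have "(\<lambda>n. root n (A n)) \<longlonglongrightarrow> L"
  proof (rule order_tendstoI)
    fix a assume "a < L"
    then obtain M where M: "M \<ge> 1" "a < g M"
      unfolding L_def using bdd by (subst (asm) less_cSup_iff) auto
    \<comment> \<open>A lower bound for \<open>root N (A N)\<close> with limit \<open>g M\<close>:
      \<open>N div M\<close> copies of \<open>M\<close>, and a factor N^M lost on the
      remainder.\<close>
    define z where "z N = y M powr (real (N div M) / real N) * real N powr (- real M / real N)"
      for N :: nat
    have "(\<lambda>N. real (N div M) / real N) \<longlonglongrightarrow> 1 / real M"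
    proof (rule tendsto_sandwich)
      show "(\<lambda>N. 1 / real M - 1 / real N) \<longlonglongrightarrow> 1 / real M"
        by real_asymp
      show "(\<lambda>N. 1 / real M) \<longlonglongrightarrow> 1 / real M"
        by simp
      show "\<forall>\<^sub>F N in sequentially. 1 / real M - 1 / real N \<le> real (N div M) / real N"
        using eventually_ge_at_top[of 1]
      proof eventually_elim
        case (elim N)
        have "N \<le> M * (N div M) + M"
          using M(1) by (metis add_le_cancel_left div_mult_mod_eq less_or_eq_imp_le mod_less_divisor mult.commute less_le_trans zero_less_one)
        hence "real N \<le> real M * real (N div M) + real M"
          by (metis of_nat_add of_nat_le_iff of_nat_mult)
        hence "real N / (real M * real N) \<le> (real M * real (N div M) + real M) / (real M * real N)"
          by (intro divide_right_mono) auto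
        thus ?case
          using M(1) elim by (simp add: add_divide_distrib)
      qed
      show "\<forall>\<^sub>F N in sequentially. real (N div M) / real N \<le> 1 / real M"
        using eventually_ge_at_top[of 1]
      proof eventually_elim
        case (elim N)
        have "real M * real (N div M) \<le> real N"
          by (metis mult.commute div_times_less_eq_dividend of_nat_le_iff of_nat_mult)
        thus ?case
          using M(1) elim by (simp add: field_simps)
      qed
    qed
    hence "(\<lambda>N. y M powr (real (N div M) / real N)) \<longlonglongrightarrow> y M powr (1 / real M)"
      using M(1) y by (intro tendsto_powr2) auto
    moreover have "(\<lambda>N::nat. real N powr (- real M / real N)) \<longlonglongrightarrow> 1"
      by real_asymp
    ultimately have "z \<longlonglongrightarrow> y M powr (1 / real M) * 1"
      unfolding z_def by (rule tendsto_mult)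
    also have "y M powr (1 / real M) * 1 = g M"
      using M(1) y by (simp add: g_def root_powr_inverse)
    finally have "\<forall>\<^sub>F N in sequentially. a < z N"
      using M(2) by (rule order_tendstoD(1))
    thus "\<forall>\<^sub>F N in sequentially. a < root N (A N)"
      using eventually_ge_at_top[of M]
    proof eventually_elim
      case (elim N)
      define q where "q = N div M"
      have q: "q \<ge> 1"
        using M(1) elim(2) by (simp add: q_def div_greater_zero_iff Suc_le_eq)
      have N: "N \<ge> 1"
        using M(1) elim(2) by simp
      have eq: "q * M + N mod M = N"
        by (simp add: q_def)
      \<comment> \<open>The weight is at least 1 and is dropped.\<close>
      have "1 * y M ^ q \<le> ((real q)\<^sup>2 * (41 * real M)) * y M ^ q"
      proof (intro mult_right_mono)
        have "1 * 1 \<le> (real q)\<^sup>2 * (41 * real M)"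
          using q M(1) by (intro mult_mono) auto
        thus "1 \<le> (real q)\<^sup>2 * (41 * real M)"
          by simp
      qed (use y in auto)
      also have "\<dots> \<le> A (q * M)"
        unfolding y_def
        using almost_supermultiplicative_multiple[OF nonneg super M(1) q] by (simp add: ac_simps)
      also have "\<dots> \<le> real N ^ (N mod M) * A N"
        using quasi_mono_interpolate[OF nonneg step, of "q * M" "N mod M"] q M(1)
        unfolding eq by auto
      also have "\<dots> \<le> real N ^ M * A N"
        using N M(1) by (intro mult_right_mono power_increasing nonneg) (auto intro: less_imp_le)
      finally have "y M ^ q \<le> real N ^ M * A N"
        by simp
      hence "root N (y M ^ q) \<le> root N (real N ^ M) * root N (A N)"
        using N by (subst real_root_mult[symmetric]) (intro real_root_le_mono, auto)
      \<comment> \<open>For \<open>y M = 0\<close> both sides vanish, since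
        \<open>q \<ge> 1\<close>.\<close>
      moreover have "root N (y M ^ q) = y M powr (real q / real N)"
      proof (cases "y M = 0")
        case True
        thus ?thesis
          using q N by (simp add: zero_power)
      next
        case False
        thus ?thesis
          using N y[of M] by (simp add: root_powr_inverse powr_realpow[symmetric] powr_powr)
      qed
      moreover have "root N (real N ^ M) = real N powr (real M / real N)"
        using N by (simp add: root_powr_inverse powr_realpow[symmetric] powr_powr)
      ultimately have "z N \<le> (real N powr (real M / real N) * root N (A N)) *
          real N powr (- real M / real N)"
        unfolding z_def q_def by (intro mult_right_mono) auto
      also have "\<dots> = root N (A N)"
        using N by (simp add: powr_minus)
      finally show ?case
        using elim(1) by simp
    qed
  next
    fix a assume "a > L"
    have "(\<lambda>N::nat. (41 * real N) powr (1 / real N)) \<longlonglongrightarrow> 1"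
      by real_asymp
    from tendsto_mult_left[OF this, of L]
    have "(\<lambda>N::nat. L * (41 * real N) powr (1 / real N)) \<longlonglongrightarrow> L"
      by simp
    hence "\<forall>\<^sub>F N in sequentially. L * (41 * real N) powr (1 / real N) < a"
      using \<open>a > L\<close> by (rule order_tendstoD(2))
    thus "\<forall>\<^sub>F N in sequentially. root N (A N) < a"
      using eventually_ge_at_top[of 1]
    proof eventually_elim
      case (elim N)
      have "root N (A N) = root N (y N * (41 * real N))"
        using elim(2) by (simp add: y_def)
      also have "\<dots> = g N * (41 * real N) powr (1 / real N)"
        using elim(2) by (simp add: real_root_mult g_def root_powr_inverse powr_mult)
      also have "\<dots> \<le> L * (41 * real N) powr (1 / real N)"
        using g_le elim(2) by (intro mult_right_mono) auto
      finally show ?case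
        using elim(1) by simp
    qed
  qed
  thus ?thesis ..
qed

section \<open>From the counting inequalities to the limits\<close>

lemma root_limits_from_counts:
  fixes f t :: "nat \<Rightarrow> nat"
  assumes "t 0 = 0"
    and tf: "\<And>n. t n \<le> f n" and ft: "\<And>n. f n \<le> t (Suc n)"
    and super: "\<And>m n. m \<ge> 1 \<Longrightarrow> n \<ge> 1 \<Longrightarrow> ((m + n) choose m) * t m * t n \<le> 2 * f (m + n)"
    and bound: "\<And>n. f n \<le> 2 ^ n * Suc n ^ n"
  shows "\<exists>L. (\<lambda>n. root n (real (f n)) / real n) \<longlonglongrightarrow> L \<and>
             (\<lambda>n. root n (real (t n)) / real n) \<longlonglongrightarrow> L"
proof -
  \<comment> \<open>The shift by 1 matches the extra root: the sizes \<open>m\<close>,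
    \<open>n\<close> and \<open>m + n + 1\<close> become \<open>m + 1\<close>, \<open>n + 1\<close>
    and their sum \<open>m + n + 2\<close>.\<close>
  define A where "A N = real (t (N - 1)) / fact (N - 1)" for N
  have "\<exists>L. (\<lambda>n. root n (A n)) \<longlonglongrightarrow> L"
  proof (rule almost_supermultiplicative_root_converges)
    show "A n \<ge> 0" for n
      by (simp add: A_def)
    show "A M * A N \<le> 2 * real (M + N) * A (M + N)" if MN: "M \<ge> 1" "N \<ge> 1" for M N
    proof -
      obtain m n where mn: "M = Suc m" "N = Suc n"
        using MN by (cases M; cases N) auto
      show ?thesis
      proof (cases "m = 0 \<or> n = 0")
        case True
        thus ?thesis
          using \<open>t 0 = 0\<close> by (auto simp: A_def mn)
      next
        case False
        hence "((m + n) choose m) * t m * t n \<le> 2 * t (Suc (m + n))"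
          using super[of m n] ft[of "m + n"] by linarith
        hence "real ((m + n) choose m) * real (t m) * real (t n) \<le> 2 * real (t (Suc (m + n)))"
          by (metis of_nat_le_iff of_nat_mult of_nat_numeral)
        moreover have "real ((m + n) choose m) = fact (m + n) / (fact m * fact n)"
          by (subst binomial_fact) auto
        ultimately have "fact (m + n) * (A M * A N) \<le> 2 * real (t (Suc (m + n)))"
          by (simp add: A_def mn field_simps)
        \<comment> \<open>Since \<open>A (M + N)\<close> divides by the factorial of
          \<open>m + n + 1\<close>, a factor \<open>m + n + 1\<close> appears; it is then relaxed to
          \<open>M + N\<close>.\<close>
        also have "\<dots> = fact (m + n) * (2 * real (Suc (m + n)) * A (M + N))"
          by (simp add: A_def mn del: of_nat_Suc of_nat_add)
        finally have "A M * A N \<le> 2 * real (Suc (m + n)) * A (M + N)"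
          by (rule mult_left_le_imp_le) simp
        also have "\<dots> \<le> 2 * real (M + N) * A (M + N)"
          by (intro mult_right_mono) (auto simp: mn A_def)
        finally show ?thesis .
      qed
    qed
    show "A n \<le> real n * A (Suc n)" if "n \<ge> 1" for n
    proof -
      obtain m where m: "n = Suc m"
        using \<open>n \<ge> 1\<close> by (cases n) auto
      have "t m \<le> t (Suc m)"
        using tf[of m] ft[of m] by linarith
      thus ?thesis
        by (simp add: A_def m divide_right_mono)
    qed
    show "A n \<le> (2 * exp 1) ^ n" if "n \<ge> 1" for n
    proof -
      obtain m where m: "n = Suc m"
        using \<open>n \<ge> 1\<close> by (cases n) auto
      have "real (t m) \<le> real (2 ^ m * Suc m ^ m)"
        using tf[of m] bound[of m] by linarith
      also have "\<dots> = 2 ^ m * real (Suc m) ^ m"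
        by simp
      also have "\<dots> \<le> 2 ^ Suc m * (fact m * exp (real (Suc m)))"
      proof (intro mult_mono)
        \<comment> \<open>The Stirling bound at \<open>m + 1\<close>, from which one factor
          \<open>m + 1\<close> is cancelled.\<close>
        have "real (Suc m) * real (Suc m) ^ m \<le> real (Suc m) * (fact m * exp (real (Suc m)))"
          using power_le_fact_exp[of "Suc m"] by (simp add: algebra_simps)
        thus "real (Suc m) ^ m \<le> fact m * exp (real (Suc m))"
          by (rule mult_left_le_imp_le) simp
      qed auto
      finally have "A n \<le> 2 ^ n * exp (real n)"
        by (simp add: A_def m field_simps)
      also have "exp (real n) = exp 1 ^ n"
        by (simp add: exp_of_nat_mult[symmetric])
      finally show ?thesis
        by (simp add: power_mult_distrib)
    qed
  qed simp
  then obtain K where K: "(\<lambda>n. root n (A n)) \<longlonglongrightarrow> K" ..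
  have inv_root: "(\<lambda>n::nat. 1 / real n powr (1 / real n)) \<longlonglongrightarrow> 1"
    by real_asymp
  define u where "u n = real (t (n - 1))" for n
  \<comment> \<open>As (n-1)! = n!/n, the root of \<open>u n\<close> splits into that of
    \<open>A n\<close>, that of n!, which gives 1/e after division by n, and n^(-1/n), which tends
    to 1.\<close>
  have "(\<lambda>n. root n (A n) * (root n (fact n) / real n * (1 / real n powr (1 / real n))))
      \<longlonglongrightarrow> K * (exp (-1) * 1)"
    by (intro tendsto_mult K root_fact_over_n inv_root)
  moreover have "\<forall>\<^sub>F n in sequentially. root n (A n) * (root n (fact n) / real n *
      (1 / real n powr (1 / real n))) = root n (u n) / real n"
    using eventually_ge_at_top[of 1]
  proof eventually_elim
    case (elim n)
    have "u n = A n * (fact n / real n)"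
      using elim by (simp add: u_def A_def fact_reduce)
    thus ?case
      using elim by (simp add: real_root_mult real_root_divide root_powr_inverse)
  qed
  ultimately have u: "(\<lambda>n. root n (u n) / real n) \<longlonglongrightarrow> K * (exp (-1) * 1)"
    using Lim_transform_eventually by fastforce
  define L where "L = K * (exp (-1) * 1)"
  \<comment> \<open>One shift passes from \<open>u\<close> to \<open>t\<close>; a second one gives
    the upper end of the sandwich around \<open>f\<close>.\<close>
  have t: "(\<lambda>n. root n (real (t n)) / real n) \<longlonglongrightarrow> L"
    using root_shift[OF u] unfolding L_def by (simp add: u_def)
  have t_Suc: "(\<lambda>n. root n (real (t (Suc n))) / real n) \<longlonglongrightarrow> L"
    using root_shift[OF t] by simp
  have "(\<lambda>n. root n (real (f n)) / real n) \<longlonglongrightarrow> L"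
  proof (rule tendsto_sandwich[OF _ _ t t_Suc])
    show "\<forall>\<^sub>F n in sequentially. root n (real (t n)) / real n \<le> root n (real (f n)) / real n"
      using eventually_ge_at_top[of 1]
      by eventually_elim (intro divide_right_mono real_root_le_mono, use tf in auto)
    show "\<forall>\<^sub>F n in sequentially. root n (real (f n)) / real n \<le> root n (real (t (Suc n))) / real n"
      using eventually_ge_at_top[of 1]
      by eventually_elim (intro divide_right_mono real_root_le_mono, use ft in auto)
  qed
  thus ?thesis
    using t by blast
qed

subsection \<open>Forests avoiding a set of patterns\<close>

theorem theorem1p2:
  fixes S :: "nat list set"
  assumes "\<forall>\<pi>\<in>S. is_pattern \<pi>"
    and "(\<forall>\<pi>\<in>S. hd \<pi> \<noteq> 1) \<or> (\<forall>\<pi>\<in>S. hd \<pi> \<noteq> length \<pi>)"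
  shows "\<exists>L::real.
    (\<lambda>n. root n (real (num_forests S n)) / real n) \<longlonglongrightarrow> L \<and>
    (\<lambda>n. root n (real (num_trees S n)) / real n) \<longlonglongrightarrow> L"
proof (rule root_limits_from_counts)
  \<comment> \<open>The empty forest is not a tree. This value settles the case of an index 1 in the
    inequality for \<open>A\<close>.\<close>
  show "num_trees S 0 = 0"
    by (simp add: num_trees_def rooted_tree_on_def)
  show "num_trees S n \<le> num_forests S n" for n
    unfolding num_trees_eq num_forests_eq
    by (intro card_mono finite_forests trees_subset_forests) simp
  show "num_forests S n \<le> num_trees S (Suc n)" for n
    using assms by (rule num_forests_le_num_trees_Suc)
qed (fact num_trees_supermultiplicative num_forests_le)+

end
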